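(* Let $\Gamma\equiv(f=0)$ be a singular branch at $(\mathbb{C}^2,0)$ with conductor $c$, and let $X=A(x,y)\frac{\partial}{\partial x}+B(x,y)\frac{\partial}{\partial y}$ be any singular holomorphic vector field for which $\Gamma$ is not invariant. If $\omega=-B(x,y)\,dx+A(x,y)\,dy$, then $$c=\mathrm{tang}_{(0,0)}(X,\Gamma)-\upsilon_\Gamma(\omega)+1 .$$
   Context: A branch is a reduced irreducible germ of analytic curve $\Gamma=(f=0)$ at $(0,0)$, with $f\in\mathbb{C}\{x,y\}$ irreducible. $X$ singular means $A(0,0)=B(0,0)=0$. $\Gamma$ is invariant for $X$ if $X(f)\in(f)$. For $g\in\mathbb{C}\{x,y\}$ not divisible by $f$, $(f,g)_{(0,0)}=\dim_{\mathbb{C}}\mathbb{C}\{x,y\}/(f,g)$ is the intersection multiplicity; it equals $\mathrm{ord}_t\,g(\varphi(t))$ for any irreducible (i.e. primitive) parametrization $\varphi(t)$ of $\Gamma$. The tangency order is $\mathrm{tang}_{(0,0)}(X,\Gamma)=(X(f),f)_{(0,0)}$. The semigroup of $\Gamma$ is $S_\Gamma=\{(f,g)_{(0,0)}: g\in\mathbb{C}\{x,y\},\ f\nmid g\}\subset\mathbb{N}$ and the conductor $c$ is the least $c\in S_\Gamma$ such that every integer $p\ge c$ belongs to $S_\Gamma$. If $(x(t),y(t))$ is an irreducible parametrization of $\Gamma$ and $\omega=a\,dx+b\,dy$, then $\upsilon_\Gamma(\omega)=\mathrm{ord}_t\big(a(x(t),y(t))\dot x(t)+b(x(t),y(t))\dot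 y(t)\big)+1$. *)

theory Defs
  imports
    "HOL-Analysis.Analysis"
    "HOL-Algebra.Embedded_Algebras"
    "HOL-Algebra.Algebraic_Closure_Type"
begin

text \<open>
  An element of \<open>complex fps fps\<close> is read as a series in \<open>y\<close> whose coefficients are series in \<open>x\<close>:
  the coefficient of \<open>x ^ i * y ^ j\<close> in \<open>F\<close> is \<open>fps_nth (fps_nth F j) i\<close>.
\<close>

definition convergent_fps2 :: "complex fps fps \<Rightarrow> bool" where
  "convergent_fps2 F \<longleftrightarrow>
     (\<exists>r>0. (\<lambda>(i, j). norm (fps_nth (fps_nth F j) i) * r ^ i * r ^ j) summable_on UNIV)"

lemma convergent_fps2_iff_bound:
  "convergent_fps2 F \<longleftrightarrow> (\<exists>C r. r > 0 \<and> (\<forall>i j. norm (fps_nth (fps_nth F j) i) \<le> C * r ^ (i + j)))"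
proof
  assume "convergent_fps2 F"
  then obtain r where r: "r > 0"
    and s: "(\<lambda>(i, j). norm (fps_nth (fps_nth F j) i) * r ^ i * r ^ j) summable_on UNIV"
    unfolding convergent_fps2_def by blast
  let ?f = "\<lambda>(i, j). norm (fps_nth (fps_nth F j) i) * r ^ i * r ^ j"
  have "norm (fps_nth (fps_nth F j) i) \<le> infsum ?f UNIV * (1 / r) ^ (i + j)" for i j
  proof -
    have "sum ?f {(i, j)} \<le> infsum ?f UNIV"
      by (rule finite_sum_le_infsum) (use s r in \<open>auto simp: case_prod_unfold\<close>)
    then show ?thesis
      using r by (simp add: power_divide power_add field_simps)
  qed
  then show "\<exists>C r. r > 0 \<and> (\<forall>i j. norm (fps_nth (fps_nth F j) i) \<le> C * r ^ (i + j))"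
    using r by (intro exI[of _ "infsum ?f UNIV"] exI[of _ "1 / r"]) auto
next
  assume "\<exists>C r. r > 0 \<and> (\<forall>i j. norm (fps_nth (fps_nth F j) i) \<le> C * r ^ (i + j))"
  then obtain C r where r: "(r::real) > 0"
    and b: "\<And>i j. norm (fps_nth (fps_nth F j) i) \<le> C * r ^ (i + j)" by blast
  define q where "q = 1 / (2 * r)"
  have q: "q > 0" "r * q = 1 / 2" using r by (auto simp: q_def)
  have geo: "((\<lambda>j. (1 / 2 :: real) ^ j) has_sum 2) UNIV"
    using geometric_sums[of "1 / 2 :: real"]
    by (subst norm_summable_imp_has_sum) (auto simp: summable_geometric)
  have "(\<lambda>(i, j). C * ((1 / 2) ^ i * (1 / 2) ^ j)) summable_on (UNIV \<times> (UNIV :: nat set))"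
  proof -
    have "(\<lambda>(i, j). (1 / 2 :: real) ^ i * (1 / 2) ^ j) summable_on (SIGMA i:(UNIV::nat set). (UNIV :: nat set))"
    proof (rule summable_on_SigmaI[where g = "\<lambda>i. (1 / 2) ^ i * 2"])
      show "(\<lambda>i. (1 / 2 :: real) ^ i * 2) summable_on UNIV"
        using geo by (intro summable_on_cmult_left) (auto simp: summable_on_def)
    qed (use geo in \<open>auto intro!: has_sum_cmult_right\<close>)
    then show ?thesis
      using summable_on_cmult_right[of "\<lambda>(i, j). (1 / 2 :: real) ^ i * (1 / 2) ^ j" _ C]
      by (simp add: case_prod_unfold)
  qed
  then have "(\<lambda>(i, j). norm (fps_nth (fps_nth F j) i) * q ^ i * q ^ j) summable_on UNIV \<times> UNIV"
  proof (rule summable_on_comparison_test)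
    fix p :: "nat \<times> nat"
    obtain i j where p: "p = (i, j)" by force
    have "norm (fps_nth (fps_nth F j) i) * (q ^ i * q ^ j) \<le> C * r ^ (i + j) * (q ^ i * q ^ j)"
      using b q by (intro mult_right_mono) auto
    also have "\<dots> = C * ((r * q) ^ i * (r * q) ^ j)"
      by (simp add: power_add power_mult_distrib)
    finally show "(case p of (i, j) \<Rightarrow> norm (fps_nth (fps_nth F j) i) * q ^ i * q ^ j)
        \<le> (case p of (i, j) \<Rightarrow> C * ((1 / 2) ^ i * (1 / 2) ^ j))"
      using p q by (simp add: mult.assoc)
  qed (use q in auto)
  then show "convergent_fps2 F"
    unfolding convergent_fps2_def UNIV_Times_UNIV using q(1) by blast
qed

lemma convergent_fps2_boundE:
  assumes "convergent_fps2 F"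
  obtains C r where "C > 0" "r > 0" "\<And>i j s. s \<ge> r \<Longrightarrow> norm (fps_nth (fps_nth F j) i) \<le> C * s ^ (i + j)"
proof -
  from assms obtain C r where r: "r > 0" "\<And>i j. norm (fps_nth (fps_nth F j) i) \<le> C * r ^ (i + j)"
    unfolding convergent_fps2_iff_bound by blast
  show ?thesis
  proof (rule that[of "\<bar>C\<bar> + 1" r])
    fix i j :: nat and s assume s: "s \<ge> r"
    have "norm (fps_nth (fps_nth F j) i) \<le> C * r ^ (i + j)" by (rule r)
    also have "\<dots> \<le> (\<bar>C\<bar> + 1) * s ^ (i + j)"
      using s r(1) by (intro mult_mono power_mono) auto
    finally show "norm (fps_nth (fps_nth F j) i) \<le> (\<bar>C\<bar> + 1) * s ^ (i + j)" .
  qed (use r in auto)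
qed

lemma convergent_fps2_const: "convergent_fps2 (fps_const (fps_const c))"
  unfolding convergent_fps2_iff_bound
  by (rule exI[of _ "norm c"], rule exI[of _ 1]) auto

lemma convergent_fps2_add:
  assumes "convergent_fps2 F" "convergent_fps2 G"
  shows "convergent_fps2 (F + G)"
proof -
  obtain C r where F: "C > 0" "r > 0"
    "\<And>i j s. s \<ge> r \<Longrightarrow> norm (fps_nth (fps_nth F j) i) \<le> C * s ^ (i + j)"
    using convergent_fps2_boundE[OF assms(1)] by metis
  obtain D q where G: "D > 0" "q > 0"
    "\<And>i j s. s \<ge> q \<Longrightarrow> norm (fps_nth (fps_nth G j) i) \<le> D * s ^ (i + j)"
    using convergent_fps2_boundE[OF assms(2)] by metis
  have "norm (fps_nth (fps_nth (F + G) j) i) \<le> (C + D) * (max r q) ^ (i + j)" for i j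
    using norm_triangle_mono[OF F(3)[of "max r q" j i] G(3)[of "max r q" j i]]
    by (simp add: distrib_right)
  then show ?thesis
    unfolding convergent_fps2_iff_bound using F(2)
    by (intro exI[of _ "C + D"] exI[of _ "max r q"]) auto
qed

lemma convergent_fps2_uminus: "convergent_fps2 F \<Longrightarrow> convergent_fps2 (- F)"
  unfolding convergent_fps2_def by simp

lemma convergent_fps2_mult:
  assumes "convergent_fps2 F" "convergent_fps2 G"
  shows "convergent_fps2 (F * G)"
proof -
  obtain C r where F: "C > 0" "r > 0"
    "\<And>i j s. s \<ge> r \<Longrightarrow> norm (fps_nth (fps_nth F j) i) \<le> C * s ^ (i + j)"
    using convergent_fps2_boundE[OF assms(1)] by metis
  obtain D q where G: "D > 0" "q > 0"
    "\<And>i j s. s \<ge> q \<Longrightarrow> norm (fps_nth (fps_nth G j) i) \<le> D * s ^ (i + j)"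
    using convergent_fps2_boundE[OF assms(2)] by metis
  define s where "s = max r q"
  have s: "s > 0" using F(2) by (simp add: s_def)
  have lin: "real (Suc n) \<le> 2 ^ n" for n :: nat
    by (induction n) auto
  have "norm (fps_nth (fps_nth (F * G) j) i) \<le> C * D * (2 * s) ^ (i + j)" for i j
  proof -
    have "fps_nth (fps_nth (F * G) j) i =
        (\<Sum>k=0..j. \<Sum>l=0..i. fps_nth (fps_nth F k) l * fps_nth (fps_nth G (j - k)) (i - l))"
      by (simp add: fps_mult_nth fps_sum_nth)
    also have "norm \<dots> \<le> (\<Sum>k=0..j. \<Sum>l=0..i. C * D * s ^ (i + j))"
    proof (intro order.trans[OF norm_sum] sum_mono)
      fix k l assume kl: "k \<in> {0..j}" "l \<in> {0..i}"
      have "norm (fps_nth (fps_nth F k) l * fps_nth (fps_nth G (j - k)) (i - l))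
          \<le> (C * s ^ (l + k)) * (D * s ^ (i - l + (j - k)))"
        unfolding norm_mult using F(1) s
        by (intro mult_mono F(3) G(3)) (auto simp: s_def)
      also have "\<dots> = C * D * s ^ ((l + k) + (i - l + (j - k)))"
        by (simp add: power_add)
      also have "(l + k) + (i - l + (j - k)) = i + j" using kl by auto
      finally show "norm (fps_nth (fps_nth F k) l * fps_nth (fps_nth G (j - k)) (i - l))
          \<le> C * D * s ^ (i + j)" .
    qed
    also have "\<dots> = C * D * s ^ (i + j) * (real (Suc j) * real (Suc i))" by simp
    also have "\<dots> \<le> C * D * s ^ (i + j) * (2 ^ j * 2 ^ i)"
      using F(1) G(1) s by (intro mult_left_mono mult_mono lin) auto
    also have "\<dots> = C * D * (2 * s) ^ (i + j)"
      by (simp add: power_add power_mult_distrib)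
    finally show ?thesis .
  qed
  then show ?thesis
    unfolding convergent_fps2_iff_bound using s
    by (intro exI[of _ "C * D"] exI[of _ "2 * s"]) auto
qed

lemma convergent_fps2_deriv_aux:
  assumes "convergent_fps2 F"
    and "\<And>i j. \<exists>m \<le> i + j. norm (fps_nth (fps_nth G j) i) \<le> real (Suc m) * norm (fps_nth (fps_nth F (b + j)) (a + i))"
  shows "convergent_fps2 G"
proof -
  obtain C r where F: "C > 0" "r > 0"
    "\<And>i j s. s \<ge> r \<Longrightarrow> norm (fps_nth (fps_nth F j) i) \<le> C * s ^ (i + j)"
    using convergent_fps2_boundE[OF assms(1)] by metis
  have lin: "real (Suc n) \<le> 2 ^ n" for n :: nat
    by (induction n) auto
  have "norm (fps_nth (fps_nth G j) i) \<le> (C * r ^ (a + b)) * (2 * r) ^ (i + j)" for i j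
  proof -
    obtain m where m: "m \<le> i + j"
      and "norm (fps_nth (fps_nth G j) i) \<le> real (Suc m) * norm (fps_nth (fps_nth F (b + j)) (a + i))"
      using assms(2) by blast
    note this(2)
    also have "\<dots> \<le> 2 ^ (i + j) * (C * r ^ ((a + i) + (b + j)))"
      using m order.trans[OF lin power_increasing[of m "i + j" 2]]
      by (intro mult_mono F(3)) auto
    also have "\<dots> = (C * r ^ (a + b)) * (2 * r) ^ (i + j)"
      by (simp add: power_add power_mult_distrib)
    finally show ?thesis .
  qed
  then show ?thesis
    unfolding convergent_fps2_iff_bound using F(2)
    by (intro exI[of _ "C * r ^ (a + b)"] exI[of _ "2 * r"]) auto
qed

lemma convergent_fps2_deriv_x:
  assumes "convergent_fps2 F" shows "convergent_fps2 (Abs_fps (\<lambda>j. fps_deriv (fps_nth F j)))"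
  using assms
proof (rule convergent_fps2_deriv_aux[where a = 1 and b = 0])
  fix i j
  show "\<exists>m\<le>i + j. norm (fps_nth (fps_nth (Abs_fps (\<lambda>j. fps_deriv (fps_nth F j))) j) i)
      \<le> real (Suc m) * norm (fps_nth (fps_nth F (0 + j)) (1 + i))"
    by (intro exI[of _ i]) (simp add: norm_mult del: of_nat_Suc)
qed

lemma convergent_fps2_deriv_y:
  assumes "convergent_fps2 F" shows "convergent_fps2 (fps_deriv F)"
  using assms
proof (rule convergent_fps2_deriv_aux[where a = 0 and b = 1])
  fix i j
  have "fps_nth (fps_nth (fps_deriv F) j) i = of_nat (Suc j) * fps_nth (fps_nth F (Suc j)) i"
    by (simp add: fps_of_nat[symmetric] del: of_nat_Suc)
  then show "\<exists>m\<le>i + j. norm (fps_nth (fps_nth (fps_deriv F) j) i)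
      \<le> real (Suc m) * norm (fps_nth (fps_nth F (1 + j)) (0 + i))"
    by (intro exI[of _ j]) (simp add: norm_mult del: of_nat_Suc)
qed

typedef series2 = "{F. convergent_fps2 F}"
  using convergent_fps2_const by blast

setup_lifting type_definition_series2

instantiation series2 :: comm_ring_1
begin

lift_definition zero_series2 :: series2 is 0
  using convergent_fps2_const[of 0] by simp

lift_definition one_series2 :: series2 is 1
  using convergent_fps2_const[of 1] by simp

lift_definition plus_series2 :: "series2 \<Rightarrow> series2 \<Rightarrow> series2" is "(+)"
  by (rule convergent_fps2_add)

lift_definition uminus_series2 :: "series2 \<Rightarrow> series2" is "uminus"
  by (rule convergent_fps2_uminus)

lift_definition minus_series2 :: "series2 \<Rightarrow> series2 \<Rightarrow> series2" is "(-)"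
  using convergent_fps2_add convergent_fps2_uminus by (metis diff_conv_add_uminus)

lift_definition times_series2 :: "series2 \<Rightarrow> series2 \<Rightarrow> series2" is "(*)"
  by (rule convergent_fps2_mult)

instance
  by standard (transfer; simp add: algebra_simps)+

end

definition coeff2 :: "series2 \<Rightarrow> nat \<Rightarrow> nat \<Rightarrow> complex" where
  "coeff2 g i j = fps_nth (fps_nth (Rep_series2 g) j) i"

lift_definition const2 :: "complex \<Rightarrow> series2" is "\<lambda>c. fps_const (fps_const c)"
  by (rule convergent_fps2_const)

lift_definition deriv_x :: "series2 \<Rightarrow> series2" is "\<lambda>F. Abs_fps (\<lambda>j. fps_deriv (fps_nth F j))"
  by (rule convergent_fps2_deriv_x)

lift_definition deriv_y :: "series2 \<Rightarrow> series2" is "fps_deriv"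
  by (rule convergent_fps2_deriv_y)

text \<open>
  Substitution \<open>g(x(t), y(t))\<close>, meaningful if \<open>x\<close> and \<open>y\<close> have no constant term: then
  \<open>x ^ i * y ^ j\<close> has order at least \<open>i + j\<close>, so truncating the sum at \<open>i, j \<le> n\<close> does not affect the
  \<open>n\<close>-th coefficient.
\<close>

definition subst2 :: "series2 \<Rightarrow> complex fps \<Rightarrow> complex fps \<Rightarrow> complex fps" where
  "subst2 g x y = Abs_fps (\<lambda>n. \<Sum>i\<le>n. \<Sum>j\<le>n. coeff2 g i j * fps_nth (x ^ i * y ^ j) n)"


abbreviation branch :: "series2 \<Rightarrow> bool" where
  "branch f \<equiv> Factorial_Ring.irreducible f"

text \<open>An irreducible \<open>f\<close> is a non-unit, hence vanishes at the origin.\<close>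

definition singular_branch :: "series2 \<Rightarrow> bool" where
  "singular_branch f \<longleftrightarrow> branch f \<and> coeff2 (deriv_x f) 0 0 = 0 \<and> coeff2 (deriv_y f) 0 0 = 0"

abbreviation series2_ring :: "series2 ring" where
  "series2_ring \<equiv> ring_of_type_algebra"

text \<open>
  The dimension of the quotient by the ideal \<open>(f, g)\<close> as a vector space over the image of the
  constants; it is \<open>0\<close> if \<open>(f, g)\<close> is the whole ring.
\<close>

definition intersection_mult :: "series2 \<Rightarrow> series2 \<Rightarrow> nat" where
  "intersection_mult f g =
     (let I = genideal series2_ring {f, g}; Q = series2_ring Quot I
      in ring.dim Q (range (\<lambda>c. I +>\<^bsub>series2_ring\<^esub> const2 c)) (carrier Q))"

definition branch_semigroup :: "series2 \<Rightarrow> nat set" where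
  "branch_semigroup f = {intersection_mult f g | g. \<not> f dvd g}"

definition conductor :: "series2 \<Rightarrow> nat" where
  "conductor f = (LEAST c. c \<in> branch_semigroup f \<and> (\<forall>p\<ge>c. p \<in> branch_semigroup f))"

definition vector_field :: "series2 \<Rightarrow> series2 \<Rightarrow> series2 \<Rightarrow> series2" where
  "vector_field A B g = A * deriv_x g + B * deriv_y g"

definition singular_vector_field :: "series2 \<Rightarrow> series2 \<Rightarrow> bool" where
  "singular_vector_field A B \<longleftrightarrow> coeff2 A 0 0 = 0 \<and> coeff2 B 0 0 = 0"

definition invariant_branch :: "series2 \<Rightarrow> series2 \<Rightarrow> series2 \<Rightarrow> bool" where
  "invariant_branch A B f \<longleftrightarrow> f dvd vector_field A B f"

definition tang :: "series2 \<Rightarrow> series2 \<Rightarrow> series2 \<Rightarrow> nat" where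
  "tang A B f = intersection_mult (vector_field A B f) f"

definition convergent_fps :: "complex fps \<Rightarrow> bool" where
  "convergent_fps u \<longleftrightarrow> fps_conv_radius u > 0"

definition parametrization :: "series2 \<Rightarrow> complex fps \<Rightarrow> complex fps \<Rightarrow> bool" where
  "parametrization f x y \<longleftrightarrow>
     convergent_fps x \<and> convergent_fps y \<and> fps_nth x 0 = 0 \<and> fps_nth y 0 = 0 \<and>
     (x \<noteq> 0 \<or> y \<noteq> 0) \<and> subst2 f x y = 0"

text \<open>A parametrization is irreducible if it is not obtained from another curve by a
  substitution of order at least two.\<close>

definition irreducible_parametrization :: "series2 \<Rightarrow> complex fps \<Rightarrow> complex fps \<Rightarrow> bool" where
  "irreducible_parametrization f x y \<longleftrightarrow>
     parametrization f x y \<and>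
     \<not> (\<exists>u v s. convergent_fps u \<and> convergent_fps v \<and> convergent_fps s \<and>
          fps_nth s 0 = 0 \<and> subdegree s \<ge> 2 \<and> x = fps_compose u s \<and> y = fps_compose v s)"

text \<open>
  As \<open>subdegree 0 = 0\<close>, this has its intended meaning only if the form does not vanish identically
  along the curve; for the form \<open>- B dx + A dy\<close> this is the non-invariance of the curve.
\<close>

definition form_val :: "complex fps \<Rightarrow> complex fps \<Rightarrow> series2 \<Rightarrow> series2 \<Rightarrow> nat" where
  "form_val x y a b =
     subdegree (subst2 a x y * fps_deriv x + subst2 b x y * fps_deriv y) + 1"

end

(*
Reparametrize the curve as (t^n, v(t)) and let W be the product of Y - v(z t) over the n-th roots of
unity z. Irreducibility of the parametrization makes the v(z t) distinct, so W generates the kernel of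
g |-> g(t^n, v(t)), hence f is a unit times W. Let D be the product of v(t) - v(z t) over z /= 1, so that
f_y has the order of D along the curve. Lagrange interpolation produces, for every convergent b, some g
with n t^(n-1) g(t^n, v(t)) = b D; so every order from ord D - (n-1) on is attained. If ord D - n were
attained by g, then comparing t^n g with its Lagrange interpolant modulo W at t = 0 would equate a nonzero
multiple of Y^(n-1) with a multiple of Y^n. Hence the conductor is ord D - (n-1) = ord f_y - ord x'.
As f vanishes on the curve, f_x x' + f_y y' = 0, which gives x' X(f) = - f_y (A y' - B x') along it, and
the theorem follows by comparing orders.
*)
theory Submission
  imports Defs "HOL-Complex_Analysis.Complex_Analysis"
begin

text \<open>The code defines \<open>intersection_mult\<close> as the dimension of a quotient ring,
  whereas the argument computes orders along the curve, so the two have to be identified.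
  Interpolation does this as well: it shows that every convergent series of order at least
  \<open>conductor_bound\<close> is the restriction of some g to the curve. Hence the quotient by
  (f, g) is finite-dimensional, and its dimension is a count of orders in the semigroup.

  Everything has to stay inside the convergent series. For this reason division by Y - v is explicit
  and estimated, divisibility by W is obtained one linear factor at a time, and series invariant
  under t -> z t are brought back to series in x = t^n by sampling coefficients. No preparation
  theorem is invoked: W turns out to generate the kernel, and irreducibility of f makes it the
  Weierstrass form of f.

  The reparametrization by t^n requires x(t) to be nonzero. Singularity of the branch guarantees
  this, since a branch on the line x = 0 is smooth.\<close>

text \<open>
  A series over \<open>'a fps\<close> is read as a series in \<open>Y\<close> with coefficients in \<open>'a[[t]]\<close>, to be evaluated at
  \<open>Y = v\<close> with \<open>v\<close> of positive order; as \<open>v ^ m\<close> has order at least \<open>m\<close>, truncating at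
  \<open>m \<le> n\<close> loses nothing. Algebraic properties of evaluation follow from the uniqueness of the
  decomposition \<open>F = c + (Y - v) Q\<close>, in which \<open>c\<close> is the value.
\<close>

definition tail_eval :: "'a::comm_ring_1 fps fps \<Rightarrow> 'a fps \<Rightarrow> nat \<Rightarrow> 'a fps" where
  "tail_eval F v j = Abs_fps (\<lambda>n. \<Sum>m\<le>n. fps_nth (fps_nth F (j + m) * v ^ m) n)"

definition eval_at :: "'a::comm_ring_1 fps fps \<Rightarrow> 'a fps \<Rightarrow> 'a fps" where
  "eval_at F v = tail_eval F v 0"

definition quot_at :: "'a::comm_ring_1 fps fps \<Rightarrow> 'a fps \<Rightarrow> 'a fps fps" where
  "quot_at F v = Abs_fps (\<lambda>j. tail_eval F v (Suc j))"

abbreviation lin :: "'a::comm_ring_1 fps \<Rightarrow> 'a fps fps" where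
  "lin v \<equiv> fps_X - fps_const v"

lemma fps_nth_mult_power_zero:
  fixes v :: "'a::comm_ring_1 fps"
  assumes "fps_nth v 0 = 0" "n < m"
  shows "fps_nth (a * v ^ m) n = 0"
proof -
  have "fps_nth (v ^ m) k = 0" if "k \<le> n" for k
    using startsby_zero_power_prefix[OF assms(1), of m] that assms(2) by auto
  then show ?thesis by (auto simp: fps_mult_nth intro!: sum.neutral)
qed

text \<open>Horner's rule: \<open>tail_eval F v j\<close> is the truncated form of the sum of
  F_(j+m) v^m. The inner truncation can be raised from \<open>n - i\<close> to \<open>n\<close>
  because the added terms have too high an order to contribute.\<close>

lemma tail_eval_rec:
  assumes v: "fps_nth v 0 = 0"
  shows "tail_eval F v j = fps_nth F j + v * tail_eval F v (Suc j)"
proof (rule fps_ext)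
  fix n
  have "fps_nth (v * tail_eval F v (Suc j)) n =
      (\<Sum>i=0..n. fps_nth v i * (\<Sum>m\<le>n - i. fps_nth (fps_nth F (Suc j + m) * v ^ m) (n - i)))"
    by (simp add: fps_mult_nth tail_eval_def)
  also have "\<dots> = (\<Sum>i=0..n. \<Sum>m\<le>n. fps_nth v i * fps_nth (fps_nth F (Suc j + m) * v ^ m) (n - i))"
    unfolding sum_distrib_left
    by (intro sum.cong sum.mono_neutral_left) (auto simp: fps_nth_mult_power_zero v)
  also have "\<dots> = (\<Sum>m\<le>n. fps_nth (v * (fps_nth F (Suc j + m) * v ^ m)) n)"
    by (subst sum.swap) (simp add: fps_mult_nth[of v])
  also have "\<dots> = (\<Sum>m\<le>n. fps_nth (fps_nth F (j + Suc m) * v ^ Suc m) n)"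
    by (intro sum.cong) (auto simp: algebra_simps)
  also have "\<dots> = (\<Sum>m\<in>{1..n}. fps_nth (fps_nth F (j + m) * v ^ m) n)"
  proof -
    have "(\<Sum>m\<le>n. fps_nth (fps_nth F (j + Suc m) * v ^ Suc m) n)
        = (\<Sum>m\<in>{1..Suc n}. fps_nth (fps_nth F (j + m) * v ^ m) n)"
      by (simp only: sum.shift_bounds_cl_Suc_ivl One_nat_def atMost_atLeast0)
    then show ?thesis by (simp add: fps_nth_mult_power_zero[OF v, of n "Suc n"] del: power_Suc)
  qed
  finally have "fps_nth (v * tail_eval F v (Suc j)) n =
      (\<Sum>m\<in>{1..n}. fps_nth (fps_nth F (j + m) * v ^ m) n)" .
  moreover have "{..n} = insert 0 {1..n}" by auto
  ultimately show "fps_nth (tail_eval F v j) n = fps_nth (fps_nth F j + v * tail_eval F v (Suc j)) n"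
    by (simp add: tail_eval_def)
qed

text \<open>Synthetic division: the Horner tails are the coefficients of the quotient.\<close>

lemma eval_at_decomp:
  assumes v: "fps_nth v 0 = 0"
  shows "F = fps_const (eval_at F v) + lin v * quot_at F v"
proof (rule fps_ext)
  fix j show "fps_nth F j = fps_nth (fps_const (eval_at F v) + lin v * quot_at F v) j"
    using tail_eval_rec[OF v, of F j]
    by (cases j) (auto simp: eval_at_def quot_at_def left_diff_distrib)
qed

text \<open>Subtracting two decompositions gives a constant equal to (Y - v) P. Comparing
  coefficients yields P_j = v P_(j+1), so P_0 is divisible by every power of v and vanishes.\<close>

lemma eval_at_unique:
  fixes v :: "'a::idom fps"
  assumes v: "fps_nth v 0 = 0" and F: "F = fps_const c + lin v * Q"
  shows "eval_at F v = c"
proof -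
  define d P where "d = c - eval_at F v" and "P = quot_at F v - Q"
  have "fps_const d = lin v * P"
  proof -
    have "fps_const c + lin v * Q = fps_const (eval_at F v) + lin v * quot_at F v"
      using eval_at_decomp[OF v, of F] F by simp
    then have "fps_const c - fps_const (eval_at F v) = lin v * P"
      by (simp add: P_def algebra_simps del: fps_const_sub)
    then show ?thesis by (simp add: d_def)
  qed
  then have *: "fps_nth (fps_const d) j = fps_nth (lin v * P) j" for j by simp
  have d: "d = - v * fps_nth P 0" using *[of 0] by (simp add: left_diff_distrib)
  have P: "fps_nth P j = v * fps_nth P (Suc j)" for j
    using *[of "Suc j"] by (simp add: left_diff_distrib)
  have "fps_nth P 0 = v ^ k * fps_nth P k" for k
  proof (induction k)
    case (Suc k) then show ?case using P[of k] by (simp add: algebra_simps)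
  qed simp
  then have "fps_nth (fps_nth P 0) n = 0" for n
    using fps_nth_mult_power_zero[OF v, of n "Suc n" "fps_nth P (Suc n)"] by (metis lessI mult.commute)
  then have "fps_nth P 0 = 0" by (intro fps_ext) simp
  then show ?thesis using d by (simp add: d_def)
qed

context
  fixes v :: "'a::idom fps"
  assumes v: "fps_nth v 0 = 0"
begin

lemma eval_at_const [simp]: "eval_at (fps_const c) v = c"
  by (rule eval_at_unique[OF v, where Q = 0]) simp

lemma eval_at_0 [simp]: "eval_at 0 v = 0"
  using eval_at_const[of 0] by simp

lemma eval_at_1 [simp]: "eval_at 1 v = 1"
  using eval_at_const[of 1] by simp

lemma eval_at_X [simp]: "eval_at fps_X v = v"
  by (rule eval_at_unique[OF v, where Q = 1]) simp

lemma eval_at_add: "eval_at (F + G) v = eval_at F v + eval_at G v"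
proof (rule eval_at_unique[OF v, where Q = "quot_at F v + quot_at G v"])
  show "F + G = fps_const (eval_at F v + eval_at G v) + lin v * (quot_at F v + quot_at G v)"
    by (subst (1) eval_at_decomp[OF v, of F], subst (1) eval_at_decomp[OF v, of G])
       (simp add: distrib_left flip: fps_const_add)
qed

lemma eval_at_mult: "eval_at (F * G) v = eval_at F v * eval_at G v"
proof (rule eval_at_unique[OF v])
  let ?a = "fps_const (eval_at F v)" and ?b = "fps_const (eval_at G v)"
  have "F * G = (?a + lin v * quot_at F v) * G"
    using eval_at_decomp[OF v, of F] by simp
  also have "\<dots> = ?a * G + lin v * (quot_at F v * G)" by (simp add: algebra_simps)
  also have "?a * G = ?a * (?b + lin v * quot_at G v)"
    using eval_at_decomp[OF v, of G] by simp
  finally show "F * G = fps_const (eval_at F v * eval_at G v)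
      + lin v * (?a * quot_at G v + quot_at F v * G)"
    by (simp add: algebra_simps del: fps_const_mult flip: fps_const_mult[of "eval_at F v"])
qed

lemma eval_at_uminus: "eval_at (- F) v = - eval_at F v"
  using eval_at_add[of F "- F"] by (simp add: add_eq_0_iff2)

lemma eval_at_diff: "eval_at (F - G) v = eval_at F v - eval_at G v"
  using eval_at_add[of F "- G"] by (simp add: eval_at_uminus)

lemma eval_at_sum: "eval_at (\<Sum>i\<in>I. F i) v = (\<Sum>i\<in>I. eval_at (F i) v)"
  by (induction I rule: infinite_finite_induct) (auto simp: eval_at_add)

lemma eval_at_prod: "eval_at (\<Prod>i\<in>I. F i) v = (\<Prod>i\<in>I. eval_at (F i) v)"
  by (induction I rule: infinite_finite_induct) (auto simp: eval_at_mult)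

lemma eval_at_eq_0D: "eval_at F v = 0 \<Longrightarrow> F = lin v * quot_at F v"
  using eval_at_decomp[OF v, of F] by simp

end

section \<open>Coefficientwise homomorphisms, derivatives and division by linear factors\<close>

definition map_coeffs :: "('a \<Rightarrow> 'b) \<Rightarrow> 'a fps \<Rightarrow> 'b fps" where
  "map_coeffs h F = Abs_fps (\<lambda>j. h (fps_nth F j))"

lemma fps_nth_map_coeffs [simp]: "fps_nth (map_coeffs h F) j = h (fps_nth F j)"
  by (simp add: map_coeffs_def)

locale comm_ring_hom =
  fixes h :: "'a::comm_ring_1 \<Rightarrow> 'b::comm_ring_1"
  assumes h_1: "h 1 = 1" and h_add: "h (a + b) = h a + h b" and h_mult: "h (a * b) = h a * h b"
begin

lemma h_0: "h 0 = 0" using h_add[of 0 0] by simp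
lemma h_uminus: "h (- a) = - h a" using h_add[of a "- a"] by (simp add: h_0 add_eq_0_iff2)
lemma h_diff: "h (a - b) = h a - h b" using h_add[of a "- b"] by (simp add: h_uminus)
lemma h_sum: "h (\<Sum>i\<in>I. f i) = (\<Sum>i\<in>I. h (f i))"
  by (induction I rule: infinite_finite_induct) (auto simp: h_0 h_add)
lemma h_prod: "h (\<Prod>i\<in>I. f i) = (\<Prod>i\<in>I. h (f i))"
  by (induction I rule: infinite_finite_induct) (auto simp: h_1 h_mult)

lemma map_coeffs_const [simp]: "map_coeffs h (fps_const c) = fps_const (h c)"
  by (rule fps_ext) (auto simp: h_0)
lemma map_coeffs_X [simp]: "map_coeffs h fps_X = fps_X"
  by (rule fps_ext) (auto simp: h_0 h_1 fps_X_def)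

lemma comm_ring_hom_map_coeffs: "comm_ring_hom (map_coeffs h)"
  by standard (auto intro!: fps_ext simp: h_add h_mult h_0 h_1 fps_mult_nth h_sum)

end

text \<open>Apply \<open>h\<close> to the decomposition of F. Working with the decomposition avoids
  interchanging \<open>h\<close> with an infinite sum, so no continuity of \<open>h\<close>
  enters.\<close>

lemma eval_at_map_coeffs:
  fixes h :: "'a::idom fps \<Rightarrow> 'b::idom fps"
  assumes h: "comm_ring_hom h" and v: "fps_nth v 0 = 0" "fps_nth (h v) 0 = 0"
  shows "eval_at (map_coeffs h F) (h v) = h (eval_at F v)"
proof (rule eval_at_unique[OF v(2)])
  interpret comm_ring_hom h by fact
  interpret E: comm_ring_hom "map_coeffs h" by (rule comm_ring_hom_map_coeffs)
  show "map_coeffs h F = fps_const (h (eval_at F v)) + lin (h v) * map_coeffs h (quot_at F v)"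
    using arg_cong[OF eval_at_decomp[OF v(1), of F], of "map_coeffs h"]
    by (simp add: E.h_add E.h_mult E.h_diff)
qed

text \<open>Differentiate F = c + (Y - v) Q in t and in Y and evaluate at v: the results are c' - v'
  Q(v) and Q(v).\<close>

lemma fps_deriv_eval_at:
  fixes v :: "'a::idom fps"
  assumes v: "fps_nth v 0 = 0"
  shows "fps_deriv (eval_at F v)
    = eval_at (map_coeffs fps_deriv F) v + fps_deriv v * eval_at (fps_deriv F) v"
proof -
  define c Q where "c = eval_at F v" and "Q = quot_at F v"
  have F: "F = fps_const c + lin v * Q" unfolding c_def Q_def by (rule eval_at_decomp[OF v])
  have "map_coeffs fps_deriv F = fps_const (fps_deriv c) - fps_const (fps_deriv v) * Q
      + lin v * map_coeffs fps_deriv Q"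
  proof (rule fps_ext)
    fix j show "fps_nth (map_coeffs fps_deriv F) j = fps_nth (fps_const (fps_deriv c)
      - fps_const (fps_deriv v) * Q + lin v * map_coeffs fps_deriv Q) j"
      by (cases j) (simp_all add: F left_diff_distrib algebra_simps)
  qed
  then have 1: "eval_at (map_coeffs fps_deriv F) v = fps_deriv c - fps_deriv v * eval_at Q v"
    using v by (simp add: eval_at_add eval_at_diff eval_at_mult)
  have "fps_deriv F = Q + lin v * fps_deriv Q" by (simp add: F)
  then have "eval_at (fps_deriv F) v = eval_at Q v"
    using v by (simp add: eval_at_add eval_at_diff eval_at_mult)
  then show ?thesis using 1 by (simp add: c_def)
qed

text \<open>Roots are divided out one at a time; a different root survives in the quotient because
  its difference from the removed root is not a zero divisor. The invariant \<open>P\<close> lets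
  convergence be carried through the divisions.\<close>

lemma prod_lin_dvd:
  fixes y :: "'i \<Rightarrow> 'a::idom fps"
  assumes "finite I" "inj_on y I" "\<And>i. i \<in> I \<Longrightarrow> fps_nth (y i) 0 = 0"
    and "\<And>i. i \<in> I \<Longrightarrow> eval_at F (y i) = 0"
    and "P F" and "\<And>F i. i \<in> I \<Longrightarrow> P F \<Longrightarrow> P (quot_at F (y i))"
  obtains Q where "P Q" "F = (\<Prod>i\<in>I. lin (y i)) * Q"
  using assms
proof (induction I arbitrary: F thesis rule: finite_induct)
  case empty then show ?case by simp
next
  case (insert a I)
  define G where "G = quot_at F (y a)"
  have F: "F = lin (y a) * G"
    unfolding G_def using insert.prems by (intro eval_at_eq_0D) auto
  have "eval_at G (y i) = 0" if i: "i \<in> I" for i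
  proof -
    have "eval_at F (y i) = 0" "fps_nth (y i) 0 = 0" using insert.prems i by auto
    then have "(y i - y a) * eval_at G (y i) = 0"
      by (simp add: F eval_at_mult eval_at_diff)
    moreover have "y i \<noteq> y a" using insert.hyps insert.prems(2) i by (auto simp: inj_on_def)
    ultimately show ?thesis by simp
  qed
  moreover have "P G" using insert.prems by (auto simp: G_def)
  ultimately obtain Q where "P Q" "G = (\<Prod>i\<in>I. lin (y i)) * Q"
    using insert.IH[of G] insert.prems by auto
  then show ?case
    using insert.hyps by (intro insert.prems(1)[of Q]) (simp_all add: F mult.assoc)
qed

section \<open>Substitution along a parametrized curve as evaluation\<close>

text \<open>Only the first coordinate is substituted; the result is a series in Y over C[[t]], to
  which \<open>eval_at\<close> applies.\<close>

definition pull_x :: "complex fps fps \<Rightarrow> complex fps \<Rightarrow> complex fps fps" where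
  "pull_x F x = map_coeffs (\<lambda>a. a oo x) F"

lemma comm_ring_hom_compose:
  fixes x :: "'a::idom fps"
  assumes "fps_nth x 0 = 0" shows "comm_ring_hom (\<lambda>a. a oo x)"
  by standard (use assms in \<open>auto simp: fps_compose_add_distrib fps_compose_mult_distrib\<close>)

lemma subst2_eq_eval_at:
  assumes x: "fps_nth x 0 = 0"
  shows "subst2 g x y = eval_at (pull_x (Rep_series2 g) x) y"
proof (rule fps_ext)
  fix n
  have "fps_nth (eval_at (pull_x (Rep_series2 g) x) y) n =
      (\<Sum>m\<le>n. \<Sum>l=0..n. (\<Sum>i=0..l. coeff2 g i m * fps_nth (x ^ i) l) * fps_nth (y ^ m) (n - l))"
    by (simp add: eval_at_def tail_eval_def pull_x_def fps_mult_nth fps_compose_nth coeff2_def)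
  also have "\<dots> = (\<Sum>m\<le>n. \<Sum>l=0..n. (\<Sum>i\<le>n. coeff2 g i m * fps_nth (x ^ i) l) * fps_nth (y ^ m) (n - l))"
    by (intro sum.cong refl arg_cong2[of _ _ _ _ times] sum.mono_neutral_left)
       (auto simp: startsby_zero_power_prefix[OF x])
  also have "\<dots> = (\<Sum>m\<le>n. \<Sum>l=0..n. \<Sum>i\<le>n. coeff2 g i m * (fps_nth (x ^ i) l * fps_nth (y ^ m) (n - l)))"
    by (simp add: sum_distrib_right mult.assoc)
  also have "\<dots> = (\<Sum>m\<le>n. \<Sum>i\<le>n. coeff2 g i m * fps_nth (x ^ i * y ^ m) n)"
    by (rule sum.cong[OF refl], subst sum.swap) (simp add: fps_mult_nth sum_distrib_left)
  also have "\<dots> = fps_nth (subst2 g x y) n"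
    by (subst sum.swap) (simp add: subst2_def)
  finally show "fps_nth (subst2 g x y) n = fps_nth (eval_at (pull_x (Rep_series2 g) x) y) n" ..
qed

lemma comm_ring_hom_pull_x:
  assumes "fps_nth x 0 = 0" shows "comm_ring_hom (\<lambda>F. pull_x F x)"
  unfolding pull_x_def
  by (rule comm_ring_hom.comm_ring_hom_map_coeffs[OF comm_ring_hom_compose[OF assms]])

lemma comm_ring_hom_subst2:
  assumes x: "fps_nth x 0 = 0" and y: "fps_nth y 0 = 0"
  shows "comm_ring_hom (\<lambda>g. subst2 g x y)"
proof -
  interpret comm_ring_hom "\<lambda>F. pull_x F x" by (rule comm_ring_hom_pull_x[OF x])
  show ?thesis
    by standard (auto simp: subst2_eq_eval_at x y eval_at_add eval_at_mult
      one_series2.rep_eq plus_series2.rep_eq times_series2.rep_eq h_1 h_add h_mult)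
qed

lemma fps_deriv_pull_x:
  assumes x: "fps_nth x 0 = 0"
  shows "fps_deriv (pull_x (Rep_series2 g) x) = pull_x (Rep_series2 (deriv_y g)) x"
proof (rule fps_ext)
  fix n
  have "of_nat (Suc n) oo x = of_nat (Suc n)"
    by (simp add: fps_of_nat[symmetric] fps_const_compose del: of_nat_Suc)
  then show "fps_nth (fps_deriv (pull_x (Rep_series2 g) x)) n
      = fps_nth (pull_x (Rep_series2 (deriv_y g)) x) n"
    by (simp add: pull_x_def deriv_y.rep_eq fps_compose_mult_distrib[OF x] del: of_nat_Suc)
qed

lemma fps_deriv_subst2:
  assumes x: "fps_nth x 0 = 0" and y: "fps_nth y 0 = 0"
  shows "fps_deriv (subst2 g x y)
    = subst2 (deriv_x g) x y * fps_deriv x + subst2 (deriv_y g) x y * fps_deriv y"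
proof -
  have "map_coeffs fps_deriv (pull_x (Rep_series2 g) x)
      = fps_const (fps_deriv x) * pull_x (Rep_series2 (deriv_x g)) x"
    by (rule fps_ext) (simp add: pull_x_def deriv_x.rep_eq fps_compose_deriv[OF x] mult.commute)
  then show ?thesis
    by (simp add: subst2_eq_eval_at x fps_deriv_eval_at y eval_at_mult mult.commute fps_deriv_pull_x)
qed

lemma subst2_compose:
  assumes x: "fps_nth x 0 = 0" and y: "fps_nth y 0 = 0" and s: "fps_nth s 0 = 0"
  shows "subst2 g (x oo s) (y oo s) = subst2 g x y oo s"
proof -
  have "pull_x (Rep_series2 g) (x oo s) = map_coeffs (\<lambda>a. a oo s) (pull_x (Rep_series2 g) x)"
    by (rule fps_ext) (simp add: pull_x_def fps_compose_assoc x s)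
  then show ?thesis
    using eval_at_map_coeffs[OF comm_ring_hom_compose[OF s] y]
    by (simp add: subst2_eq_eval_at x y)
qed

section \<open>Convergence estimates\<close>

lemma convergent_fps_expansionI: "f has_fps_expansion u \<Longrightarrow> convergent_fps u"
  by (simp add: has_fps_expansion_def convergent_fps_def)

lemma convergent_fps_expansion: "convergent_fps u \<Longrightarrow> eval_fps u has_fps_expansion u"
  by (simp add: has_fps_expansion_def convergent_fps_def)

lemma convergent_fps_compose:
  assumes "convergent_fps u" "convergent_fps s" "fps_nth s 0 = 0"
  shows "convergent_fps (u oo s)"
  using has_fps_expansion_compose[OF convergent_fps_expansion[OF assms(1)]
      convergent_fps_expansion[OF assms(2)] assms(3)]
  by (rule convergent_fps_expansionI)

lemma convergent_fps_mult:
  "convergent_fps u \<Longrightarrow> convergent_fps v \<Longrightarrow> convergent_fps (u * v)"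
  by (meson convergent_fps_expansion convergent_fps_expansionI has_fps_expansion_mult)

lemma convergent_fps_power: "convergent_fps u \<Longrightarrow> convergent_fps (u ^ k)"
  by (meson convergent_fps_expansion convergent_fps_expansionI has_fps_expansion_power)

lemma convergent_fps_add:
  "convergent_fps u \<Longrightarrow> convergent_fps v \<Longrightarrow> convergent_fps (u + v)"
  by (meson convergent_fps_expansion convergent_fps_expansionI has_fps_expansion_add)

lemma convergent_fps_const: "convergent_fps (fps_const c)"
  by (simp add: convergent_fps_def)

lemma convergent_fps_X: "convergent_fps fps_X"
  by (simp add: convergent_fps_def)

lemma convergent_fps_divide:
  assumes "convergent_fps u" "convergent_fps v" "v \<noteq> 0" "subdegree v \<le> subdegree u"
  shows "convergent_fps (u / v)"
proof (rule convergent_fps_expansionI)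
  show "(\<lambda>z. if z = 0 then fps_nth u (subdegree v) / fps_nth v (subdegree v)
      else eval_fps u z / eval_fps v z) has_fps_expansion u / v"
    by (rule has_fps_expansion_divide[OF convergent_fps_expansion convergent_fps_expansion])
       (use assms in auto)
qed

lemma convergent_fps_bound:
  assumes "convergent_fps u"
  obtains M where "M \<ge> 1" "\<And>i. norm (fps_nth u i) \<le> M * M ^ i"
proof -
  obtain r where r: "ereal r < fps_conv_radius u" "r > 0"
    using ereal_dense2[of 0 "fps_conv_radius u"] assms
    by (auto simp: convergent_fps_def zero_ereal_def)
  have "summable (\<lambda>n. norm (fps_nth u n * of_real r ^ n))"
    using r by (intro norm_summable_fps) auto
  then have "Bseq (\<lambda>n. norm (fps_nth u n * of_real r ^ n))"
    by (intro convergent_imp_Bseq convergentI[OF summable_LIMSEQ_zero])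
  then obtain B where B: "\<And>n. norm (fps_nth u n) * r ^ n \<le> B"
    using r(2) by (auto simp: Bseq_def norm_mult norm_power)
  define M where "M = max (max B (1 / r)) 1"
  show ?thesis
  proof (rule that[of M])
    fix i
    have "norm (fps_nth u i) \<le> B * (1 / r) ^ i"
      using B[of i] r(2) by (simp add: field_simps)
    also have "\<dots> \<le> M * M ^ i"
      using r(2) by (intro mult_mono power_mono) (auto simp: M_def)
    finally show "norm (fps_nth u i) \<le> M * M ^ i" .
  qed (simp add: M_def)
qed

lemma convergent_fps_boundI:
  assumes "M > 0" "\<And>i. norm (fps_nth u i) \<le> K * M ^ i"
  shows "convergent_fps u"
proof -
  have "summable (\<lambda>n. fps_nth u n * of_real (1 / (2 * M)) ^ n)"
  proof (rule summable_comparison_test[OF exI[of _ 0]], safe)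
    fix n
    have "norm (fps_nth u n * of_real (1 / (2 * M)) ^ n) \<le> K * M ^ n * (1 / (2 * M)) ^ n"
      using assms by (auto simp: norm_mult norm_power norm_divide intro!: mult_right_mono divide_right_mono)
    also have "\<dots> = K * (1 / 2) ^ n" using assms(1) by (simp add: power_divide power_mult_distrib)
    finally show "norm (fps_nth u n * of_real (1 / (2 * M)) ^ n) \<le> K * (1 / 2) ^ n" .
  qed (auto intro!: summable_mult summable_geometric)
  then have "norm (of_real (1 / (2 * M)) :: complex) \<le> fps_conv_radius u"
    unfolding fps_conv_radius_def by (rule conv_radius_geI)
  moreover have "norm (of_real (1 / (2 * M)) :: complex) > 0" using assms(1) by simp
  ultimately show ?thesis unfolding convergent_fps_def
    by (metis ereal_less(2) order_less_le_trans)
qed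

lemma convergent_fps2_bound:
  assumes "convergent_fps2 F"
  obtains M where "M \<ge> 1" "\<And>i j. norm (fps_nth (fps_nth F j) i) \<le> M * M ^ (i + j)"
proof -
  from assms obtain C r where r: "r > 0" "\<And>i j. norm (fps_nth (fps_nth F j) i) \<le> C * r ^ (i + j)"
    unfolding convergent_fps2_iff_bound by blast
  define M where "M = max (max C r) 1"
  have "C * r ^ (i + j) \<le> M * M ^ (i + j)" for i j
    using r(1) by (intro mult_mono power_mono) (auto simp: M_def)
  then show ?thesis
    using r(2) by (intro that[of M] order.trans[OF r(2)]) (auto simp: M_def)
qed

text \<open>Stretching the exponent by the factor \<open>a\<close> only replaces the base M by
  M^(a+1). Three cases are used: sampling at multiples of n, sampling at n i + (n - 1), and dividing
  by x.\<close>

lemma convergent_fps2_subsample: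
  assumes F: "convergent_fps2 F"
    and G: "\<And>i j. norm (fps_nth (fps_nth G j) i) \<le> K * norm (fps_nth (fps_nth F j) (a * i + b))"
  shows "convergent_fps2 G"
proof -
  obtain M where M: "M \<ge> 1" "\<And>i j. norm (fps_nth (fps_nth F j) i) \<le> M * M ^ (i + j)"
    using convergent_fps2_bound[OF F] by blast
  have "norm (fps_nth (fps_nth G j) i) \<le> (\<bar>K\<bar> * (M * M ^ b)) * (M ^ (a + 1)) ^ (i + j)" for i j
  proof -
    have "norm (fps_nth (fps_nth G j) i) \<le> \<bar>K\<bar> * (M * M ^ (a * i + b + j))"
      using G[of j i] M(2)[of j "a * i + b"]
      by (meson abs_ge_self abs_ge_zero mult_mono norm_ge_zero order.trans)
    also have "M ^ (a * i + b + j) \<le> M ^ (b + (a + 1) * (i + j))"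
      using M(1) by (intro power_increasing) (auto simp: algebra_simps)
    also have "\<bar>K\<bar> * (M * M ^ (b + (a + 1) * (i + j))) = (\<bar>K\<bar> * (M * M ^ b)) * (M ^ (a + 1)) ^ (i + j)"
      by (simp only: power_add power_mult mult.assoc)
    finally show ?thesis using M(1) by (simp add: mult_left_mono)
  qed
  then show ?thesis
    unfolding convergent_fps2_iff_bound using M(1)
    by (intro exI[of _ "\<bar>K\<bar> * (M * M ^ b)"] exI[of _ "M ^ (a + 1)"]) auto
qed

text \<open>The bound must be uniform in m, since evaluation sums over all powers of v. As v has no
  constant term, the factor M is absorbed into the base B = M^2. Doubling the base pays for each
  further multiplication, because the sum of 2^(-i) over i >= 1 is at most 1.\<close>

lemma convergent_power_bound:
  assumes v: "convergent_fps v" "fps_nth v 0 = 0"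
  obtains M where "M \<ge> 1" "\<And>m k. norm (fps_nth (v ^ m) k) \<le> M ^ k"
proof -
  obtain M where M: "M \<ge> 1" "\<And>i. norm (fps_nth v i) \<le> M * M ^ i"
    using convergent_fps_bound[OF v(1)] by blast
  define B where "B = M ^ 2"
  have B: "B \<ge> 1" using M(1) by (simp add: B_def)
  have vB: "norm (fps_nth v i) \<le> B ^ i" if "i > 0" for i
  proof -
    have "norm (fps_nth v i) \<le> M ^ (Suc i)" using M(2)[of i] by simp
    also have "\<dots> \<le> M ^ (2 * i)" using M(1) that by (intro power_increasing) auto
    finally show ?thesis by (simp add: B_def power_mult)
  qed
  have "(\<Sum>i=1..k. (1 / 2 :: real) ^ i) = 1 - (1 / 2) ^ k" for k
    by (induction k) (simp_all add: sum.nat_ivl_Suc')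
  then have geo: "(\<Sum>i=1..k. (1 / 2 :: real) ^ i) \<le> 1" for k by simp
  have "norm (fps_nth (v ^ m) k) \<le> (2 * B) ^ k" for m k
  proof (induction m arbitrary: k)
    case 0 then show ?case using B by (simp add: one_le_power)
  next
    case (Suc m)
    have "fps_nth (v ^ Suc m) k = (\<Sum>i=1..k. fps_nth v i * fps_nth (v ^ m) (k - i))"
      using v(2) by (simp add: fps_mult_nth sum.atLeast_Suc_atMost)
    also have "norm \<dots> \<le> (\<Sum>i=1..k. (2 * B) ^ k * (1 / 2) ^ i)"
    proof (intro order.trans[OF norm_sum] sum_mono)
      fix i assume i: "i \<in> {1..k}"
      have "norm (fps_nth v i * fps_nth (v ^ m) (k - i)) \<le> B ^ i * (2 * B) ^ (k - i)"
        unfolding norm_mult using i B by (intro mult_mono vB Suc.IH) auto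
      also have "B ^ i = (2 * B) ^ i * (1 / 2) ^ i"
        by (simp add: power_mult_distrib power_one_over)
      also have "\<dots> * (2 * B) ^ (k - i) = (2 * B) ^ k * (1 / 2) ^ i"
        using i power_add[of "2 * B" i "k - i"] by simp
      finally show "norm (fps_nth v i * fps_nth (v ^ m) (k - i)) \<le> (2 * B) ^ k * (1 / 2) ^ i" .
    qed
    also have "\<dots> = (2 * B) ^ k * (\<Sum>i=1..k. (1 / 2) ^ i)" by (simp only: sum_distrib_left)
    also have "\<dots> \<le> (2 * B) ^ k * 1" using geo B by (intro mult_left_mono) auto
    finally show ?case by simp
  qed
  then show ?thesis using B by (intro that[of "2 * B"]) auto
qed

text \<open>In the coefficient of t^k Y^j the exponents of M add up to at most 2 (k + j), and there
  are (k + 1)^2 <= 4^k terms; this is the origin of the base 4 M^2.\<close>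

lemma convergent_quot_at:
  assumes F: "convergent_fps2 F" and v: "convergent_fps v" "fps_nth v 0 = 0"
  shows "convergent_fps2 (quot_at F v)"
proof -
  obtain M1 where M1: "M1 \<ge> 1" "\<And>i j. norm (fps_nth (fps_nth F j) i) \<le> M1 * M1 ^ (i + j)"
    using convergent_fps2_bound[OF F] by blast
  obtain M2 where M2: "M2 \<ge> 1" "\<And>m k. norm (fps_nth (v ^ m) k) \<le> M2 ^ k"
    using convergent_power_bound[OF v] by blast
  define M where "M = max M1 M2"
  have M: "M \<ge> 1" using M1(1) by (simp add: M_def)
  have bF: "norm (fps_nth (fps_nth F j) i) \<le> M * M ^ (i + j)" for i j
    by (rule order.trans[OF M1(2)]) (use M1(1) in \<open>auto simp: M_def intro!: mult_mono power_mono\<close>)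
  have bv: "norm (fps_nth (v ^ m) k) \<le> M ^ k" for m k
    by (rule order.trans[OF M2(2)]) (use M2(1) in \<open>auto simp: M_def intro!: power_mono\<close>)
  have lin: "real (Suc n) \<le> 2 ^ n" for n :: nat by (induction n) auto
  have "norm (fps_nth (fps_nth (quot_at F v) j) k) \<le> (M * M) * (4 * M ^ 2) ^ (k + j)" for j k
  proof -
    have "fps_nth (fps_nth (quot_at F v) j) k =
        (\<Sum>m\<le>k. \<Sum>i=0..k. fps_nth (fps_nth F (Suc j + m)) i * fps_nth (v ^ m) (k - i))"
      by (simp add: quot_at_def tail_eval_def fps_mult_nth)
    also have "norm \<dots> \<le> (\<Sum>m\<le>k. \<Sum>i=0..k. (M * M) * M ^ (2 * (k + j)))"
    proof (intro order.trans[OF norm_sum] sum_mono)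
      fix m i assume mi: "m \<in> {..k}" "i \<in> {0..k}"
      have "norm (fps_nth (fps_nth F (Suc j + m)) i * fps_nth (v ^ m) (k - i))
          \<le> M * M ^ (i + (Suc j + m)) * M ^ (k - i)"
        unfolding norm_mult using M by (intro mult_mono bF bv) auto
      also have "\<dots> = (M * M) * M ^ (i + (j + m) + (k - i))" by (simp add: power_add)
      also have "\<dots> \<le> (M * M) * M ^ (2 * (k + j))"
        using M mi by (intro mult_left_mono power_increasing) auto
      finally show "norm (fps_nth (fps_nth F (Suc j + m)) i * fps_nth (v ^ m) (k - i))
        \<le> (M * M) * M ^ (2 * (k + j))" .
    qed
    also have "\<dots> = (M * M) * M ^ (2 * (k + j)) * (real (Suc k) * real (Suc k))" by simp
    also have "\<dots> \<le> (M * M) * M ^ (2 * (k + j)) * (2 ^ (k + j) * 2 ^ (k + j))"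
      using M by (intro mult_left_mono mult_mono order.trans[OF lin] power_increasing) auto
    also have "\<dots> = (M * M) * (4 * M ^ 2) ^ (k + j)"
    proof -
      have "(2 :: real) ^ (k + j) * 2 ^ (k + j) = 4 ^ (k + j)"
        using power_mult_distrib[of "2 :: real" 2 "k + j"] by simp
      then show ?thesis
        by (simp only: power_mult[of M 2 "k + j"] power_mult_distrib) (simp only: mult_ac)
    qed
    finally show ?thesis .
  qed
  then show ?thesis
    unfolding convergent_fps2_iff_bound using M
    by (intro exI[of _ "M * M"] exI[of _ "4 * M ^ 2"]) auto
qed

lemma convergent_fps2_nth: "convergent_fps2 F \<Longrightarrow> convergent_fps (fps_nth F j)"
proof -
  assume "convergent_fps2 F"
  then obtain M where M: "M \<ge> 1" "\<And>i j. norm (fps_nth (fps_nth F j) i) \<le> M * M ^ (i + j)"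
    using convergent_fps2_bound by blast
  then show ?thesis
    by (intro convergent_fps_boundI[of M _ "M * M ^ j"]) (auto simp: power_add mult.assoc mult.commute[of "M ^ j"])
qed

lemma convergent_fps2_fps_const: "convergent_fps u \<Longrightarrow> convergent_fps2 (fps_const u)"
proof -
  assume "convergent_fps u"
  then obtain M where M: "M \<ge> 1" "\<And>i. norm (fps_nth u i) \<le> M * M ^ i"
    using convergent_fps_bound by blast
  then show ?thesis
    unfolding convergent_fps2_iff_bound
    by (intro exI[of _ M]) auto
qed

lemma convergent_fps2_X: "convergent_fps2 fps_X"
  unfolding convergent_fps2_iff_bound
  by (rule exI[of _ 1], rule exI[of _ 1]) (auto simp: fps_X_def)

lemma convergent_fps2_lin: "convergent_fps v \<Longrightarrow> convergent_fps2 (lin v)"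
  by (metis convergent_fps2_add convergent_fps2_fps_const convergent_fps2_uminus convergent_fps2_X
      diff_conv_add_uminus)

lemma convergent_fps2_prod:
  "(\<And>i. i \<in> I \<Longrightarrow> convergent_fps2 (F i)) \<Longrightarrow> convergent_fps2 (\<Prod>i\<in>I. F i)"
  using convergent_fps2_const[of 1]
  by (induction I rule: infinite_finite_induct) (auto intro: convergent_fps2_mult)

lemma convergent_eval_at:
  assumes F: "convergent_fps2 F" and v: "convergent_fps v" "fps_nth v 0 = 0"
  shows "convergent_fps (eval_at F v)"
proof -
  have "eval_at F v = fps_nth F 0 + v * fps_nth (quot_at F v) 0"
    using tail_eval_rec[OF v(2), of F 0] by (simp add: eval_at_def quot_at_def)
  then show ?thesis
    using convergent_quot_at[OF F v] F v
    by (auto intro!: convergent_fps_add convergent_fps_mult convergent_fps2_nth)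
qed

lemma convergent_pull_X_power:
  assumes F: "convergent_fps2 F" and n: "n > 0"
  shows "convergent_fps2 (pull_x F (fps_X ^ n))"
proof -
  obtain M where M: "M \<ge> 1" "\<And>i j. norm (fps_nth (fps_nth F j) i) \<le> M * M ^ (i + j)"
    using convergent_fps2_bound[OF F] by blast
  have "norm (fps_nth (fps_nth (pull_x F (fps_X ^ n)) j) i) \<le> M * M ^ (i + j)" for i j
  proof (cases "n dvd i")
    case True
    have "norm (fps_nth (fps_nth F j) (i div n)) \<le> M * M ^ (i div n + j)" by (rule M)
    also have "\<dots> \<le> M * M ^ (i + j)" using M(1) by (intro mult_left_mono power_increasing) auto
    finally show ?thesis using True n by (simp add: pull_x_def fps_nth_compose_X_power)
  qed (use n M(1) in \<open>simp_all add: pull_x_def fps_nth_compose_X_power\<close>)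
  then show ?thesis
    unfolding convergent_fps2_iff_bound using M(1) by (intro exI[of _ M]) auto
qed

lemma convergent_subst2_X_power:
  assumes "n > 0" "convergent_fps v" "fps_nth v 0 = 0"
  shows "convergent_fps (subst2 g (fps_X ^ n) v)"
  using assms Rep_series2[of g]
  by (subst subst2_eq_eval_at) (auto intro!: convergent_eval_at convergent_pull_X_power)

section \<open>Roots and inverses of convergent series, roots of unity\<close>

text \<open>Write x = c t^n (1 + w) with w(0) = 0. The binomial series gives a convergent n-th root
  of 1 + w, and the constant c has a complex n-th root.\<close>

lemma convergent_fps_root:
  assumes x: "convergent_fps x" and n: "subdegree x = n" "n > 0"
  obtains \<tau> where "convergent_fps \<tau>" "fps_nth \<tau> 0 = 0" "fps_nth \<tau> 1 \<noteq> 0" "\<tau> ^ n = x"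
proof -
  define u where "u = fps_shift n x"
  define c where "c = fps_nth u 0"
  have x0: "x \<noteq> 0" using n by auto
  have c: "c \<noteq> 0" using n x0 by (auto simp: c_def u_def)
  have xu: "x = u * fps_X ^ n"
    using subdegree_decompose[of x] n by (simp add: u_def)
  obtain b where b: "b ^ n = c"
    using exists_complex_root[of n c] n(2) by auto
  have b0: "b \<noteq> 0" using b c n(2) by (auto simp: zero_power)
  define w where "w = fps_const (inverse c) * u - 1"
  have w0: "fps_nth w 0 = 0" using c by (simp add: w_def c_def[symmetric])
  have "convergent_fps u" using x by (simp add: u_def convergent_fps_def)
  then have "convergent_fps (fps_const (inverse c) * u + fps_const (- 1))"
    by (intro convergent_fps_add convergent_fps_mult convergent_fps_const)
  moreover have "w = fps_const (inverse c) * u + fps_const (- 1)"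
    by (simp add: w_def flip: fps_const_neg)
  ultimately have w: "convergent_fps w" by simp
  define r where "r = fps_binomial (1 / of_nat n) oo w"
  have r: "convergent_fps r"
    unfolding r_def
    by (intro convergent_fps_compose w w0 convergent_fps_expansionI[OF has_fps_expansion_binomial_complex])
  have r0: "fps_nth r 0 = 1" by (simp add: r_def)
  have "r ^ n = (fps_binomial (1 / of_nat n) ^ n) oo w"
    by (simp add: r_def fps_compose_power[OF w0])
  also have "\<dots> = 1 + w" using n(2)
    by (simp add: fps_binomial_power fps_binomial_1 fps_compose_add_distrib w0)
  finally have rn: "r ^ n = 1 + w" .
  show ?thesis
  proof (rule that[of "fps_const b * r * fps_X"])
    show "(fps_const b * r * fps_X) ^ n = x"
      using c by (simp add: power_mult_distrib rn w_def b xu fps_const_power mult.assoc[symmetric])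
  qed (use r r0 b0 in \<open>auto intro!: convergent_fps_mult convergent_fps_const convergent_fps_X\<close>)
qed

text \<open>Convergence comes from complex analysis: the function defined by s is locally injective
  at 0, and the Taylor series of its holomorphic inverse is the required series.\<close>

lemma convergent_fps_left_inverse:
  assumes s: "convergent_fps s" "fps_nth s 0 = 0" "fps_nth s 1 \<noteq> 0"
  obtains \<rho> where "convergent_fps \<rho>" "fps_nth \<rho> 0 = 0" "\<rho> oo s = fps_X"
proof -
  define f where "f = eval_fps s"
  have f: "f has_fps_expansion s" unfolding f_def by (rule convergent_fps_expansion[OF s(1)])
  obtain S where S: "open S" "0 \<in> S" "f holomorphic_on S"
    using has_fps_expansion_imp_holomorphic[OF f] by metis
  have f0: "f 0 = 0" using s(2) by (simp add: f_def eval_fps_at_0)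
  have "deriv f 0 = fps_nth s 1" using fps_nth_fps_expansion[OF f, of 1] by simp
  then obtain r where r: "r > 0" "ball 0 r \<subseteq> S" "open (f ` ball 0 r)" "inj_on f (ball 0 r)"
    using has_complex_derivative_locally_invertible[OF S(3,2,1)] s(3) by metis
  obtain g where g: "g holomorphic_on (f ` ball 0 r)" "\<And>z. z \<in> ball 0 r \<Longrightarrow> g (f z) = z"
    using holomorphic_has_inverse[of f "ball 0 r"] r S(3) holomorphic_on_subset by (metis open_ball)
  have "0 \<in> f ` ball 0 r" using r(1) f0 by (metis centre_in_ball image_eqI)
  then have "g analytic_on {0}" using g(1) r(3) analytic_at by blast
  then have G: "g has_fps_expansion fps_expansion g 0"
    by (rule analytic_at_imp_has_fps_expansion_0)
  have "(g \<circ> f) has_fps_expansion (fps_expansion g 0 oo s)"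
    by (rule has_fps_expansion_compose[OF G f s(2)])
  moreover have "eventually (\<lambda>z. (g \<circ> f) z = z) (nhds 0)"
    using g(2) r(1) eventually_nhds_in_open[of "ball 0 r" "0::complex"]
    by (auto elim!: eventually_mono)
  ultimately have "(\<lambda>z. z) has_fps_expansion (fps_expansion g 0 oo s)"
    by (subst has_fps_expansion_cong[OF _ refl, symmetric]) auto
  then have 1: "fps_expansion g 0 oo s = fps_X"
    using fps_expansion_unique_complex has_fps_expansion_fps_X by blast
  show ?thesis
  proof (rule that[of "fps_expansion g 0"])
    show "fps_nth (fps_expansion g 0) 0 = 0"
      using arg_cong[OF 1, of "\<lambda>F. fps_nth F 0"] by simp
  qed (use G 1 in \<open>auto intro: convergent_fps_expansionI\<close>)
qed

text \<open>Multiplication by the primitive root w permutes the n-th roots of unity, so the sum is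
  unchanged when multiplied by w^k, which differs from 1 unless n divides k.\<close>

lemma sum_roots_of_unity_power:
  assumes n: "n > 0"
  shows "(\<Sum>z | z ^ n = 1. (z :: complex) ^ k) = (if n dvd k then of_nat n else 0)"
proof (cases "n dvd k")
  case True
  then obtain m where "k = n * m" by auto
  then have "(\<Sum>z | z ^ n = 1. (z :: complex) ^ k) = (\<Sum>z \<in> {z :: complex. z ^ n = 1}. (1 :: complex))"
    by (auto simp: power_mult intro!: sum.cong)
  then show ?thesis using True n by (simp add: card_roots_unity_eq)
next
  case False
  define w where "w = exp (2 * of_real pi * \<i> * of_nat 1 / of_nat n)"
  have wn: "w ^ n = 1" unfolding w_def by (rule complex_root_unity) (use n in auto)
  have "w ^ k = exp (2 * of_real pi * \<i> * of_nat k / of_nat n)"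
    unfolding w_def by (simp add: algebra_simps flip: exp_of_nat_mult)
  then have wk: "w ^ k \<noteq> 1" using complex_root_unity_eq_1[of n k] n False by auto
  have w0: "w \<noteq> 0" by (simp add: w_def)
  have "(\<Sum>z | z ^ n = 1. z ^ k) = (\<Sum>z | z ^ n = 1. (w * z) ^ k)"
    by (rule sum.reindex_bij_witness[of _ "\<lambda>z. w * z" "\<lambda>z. z / w"])
       (use w0 wn in \<open>auto simp: power_mult_distrib power_divide\<close>)
  also have "\<dots> = w ^ k * (\<Sum>z | z ^ n = 1. z ^ k)"
    by (simp add: power_mult_distrib sum_distrib_left)
  finally show ?thesis using wk False by simp
qed

abbreviation rot :: "complex \<Rightarrow> complex fps \<Rightarrow> complex fps" where
  "rot z a \<equiv> a oo (fps_const z * fps_X)"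

lemma rot_nth [simp]: "fps_nth (rot z a) k = z ^ k * fps_nth a k"
  by (simp add: fps_compose_linear)

lemma comm_ring_hom_rot: "comm_ring_hom (rot z)"
  by (rule comm_ring_hom_compose) simp

lemma rot_rot: "rot z (rot w a) = rot (z * w) a"
  by (rule fps_ext) (simp add: power_mult_distrib)

lemma convergent_rot: "convergent_fps a \<Longrightarrow> convergent_fps (rot z a)"
  by (intro convergent_fps_compose convergent_fps_mult convergent_fps_const convergent_fps_X) auto

section \<open>The branch in the form (t^n, v(t)): kernel, interpolation and gap\<close>

text \<open>The last assumption is primitivity of (t^n, v(t)): no nontrivial deck transformation of
  t -> t^n fixes v.\<close>

locale branch_normal_form =
  fixes f :: series2 and n :: nat and v :: "complex fps"
  assumes branch: "Factorial_Ring.irreducible f"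
    and n_pos: "n > 0"
    and v_conv: "convergent_fps v"
    and v_0: "fps_nth v 0 = 0"
    and f_zero: "subst2 f (fps_X ^ n) v = 0"
    and rot_inj: "z ^ n = 1 \<Longrightarrow> rot z v = v \<Longrightarrow> z = 1"
begin

definition U :: "complex set" where "U = {z. z ^ n = 1}"

definition \<pi> :: "series2 \<Rightarrow> complex fps" where "\<pi> g = subst2 g (fps_X ^ n) v"

definition lift :: "series2 \<Rightarrow> complex fps fps" where "lift g = pull_x (Rep_series2 g) (fps_X ^ n)"

definition W where "W = (\<Prod>z\<in>U. lin (rot z v))"

definition W_without where "W_without w = (\<Prod>z\<in>U - {w}. lin (rot z v))"

definition D where "D = eval_at (W_without 1) v"

lemma finite_U: "finite U" and card_U: "card U = n" and one_U: "1 \<in> U"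
  unfolding U_def using n_pos finite_roots_unity[of n] card_roots_unity_eq[of n] by auto

lemma U_nonzero: "z \<in> U \<Longrightarrow> z \<noteq> 0"
  using n_pos by (auto simp: U_def zero_power)

lemma U_mult: "z \<in> U \<Longrightarrow> w \<in> U \<Longrightarrow> z * w \<in> U"
  by (simp add: U_def power_mult_distrib)

lemma U_divide: "z \<in> U \<Longrightarrow> w \<in> U \<Longrightarrow> z / w \<in> U"
  by (simp add: U_def power_divide)

lemma X_0: "fps_nth (fps_X ^ n :: complex fps) 0 = 0"
  using n_pos by simp

lemma rot_v_0: "fps_nth (rot z v) 0 = 0"
  by (simp add: v_0)

lemma rot_1: "rot 1 a = a"
  by (rule fps_ext) simp

lemma rot_X_power: "z \<in> U \<Longrightarrow> rot z (fps_X ^ n) = fps_X ^ n"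
  by (rule fps_ext) (auto simp: U_def)

sublocale lift: comm_ring_hom lift
proof -
  interpret comm_ring_hom "\<lambda>F. pull_x F (fps_X ^ n)" by (rule comm_ring_hom_pull_x[OF X_0])
  show "comm_ring_hom lift"
    by standard (auto simp: lift_def one_series2.rep_eq plus_series2.rep_eq times_series2.rep_eq
      h_1 h_add h_mult)
qed

sublocale \<pi>: comm_ring_hom \<pi>
  unfolding \<pi>_def using comm_ring_hom_subst2[OF X_0 v_0] by simp

lemma \<pi>_eq: "\<pi> g = eval_at (lift g) v"
  unfolding \<pi>_def lift_def by (rule subst2_eq_eval_at[OF X_0])

lemma inj_rot_v: "inj_on (\<lambda>z. rot z v) U"
proof (rule inj_onI)
  fix z w assume zw: "z \<in> U" "w \<in> U" "rot z v = rot w v"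
  have "rot (z / w) v = rot (1 / w) (rot z v)" by (simp add: rot_rot)
  also have "\<dots> = v" using zw U_nonzero[of w] by (simp add: rot_rot rot_1)
  finally have "z / w = 1" using rot_inj[of "z / w"] U_divide[OF zw(1,2)] by (simp add: U_def del: divide_eq_1_iff)
  then show "z = w" using U_nonzero[OF zw(2)] by simp
qed

lemma lift_rot:
  assumes "z \<in> U" shows "map_coeffs (rot z) (lift g) = lift g"
proof (rule fps_ext, rule fps_ext)
  fix j i
  have "z ^ i = 1" if "n dvd i" using that assms by (auto simp: U_def power_mult)
  then show "fps_nth (fps_nth (map_coeffs (rot z) (lift g)) j) i = fps_nth (fps_nth (lift g) j) i"
    by (auto simp: lift_def pull_x_def fps_nth_compose_X_power)
qed

text \<open>\<open>lift g\<close> involves only powers of t^n, so rotation fixes it. Hence vanishing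
  at v propagates to every conjugate of v.\<close>

lemma eval_lift_rot:
  assumes "z \<in> U" shows "eval_at (lift g) (rot z v) = rot z (\<pi> g)"
  using eval_at_map_coeffs[OF comm_ring_hom_rot v_0, of z "lift g"] assms
  by (simp add: lift_rot rot_v_0 \<pi>_eq v_0)

lemma convergent_lift: "convergent_fps2 (lift g)"
  unfolding lift_def using Rep_series2[of g] n_pos by (intro convergent_pull_X_power) auto

lemma convergent_W: "convergent_fps2 W"
  unfolding W_def by (intro convergent_fps2_prod convergent_fps2_lin convergent_rot v_conv)

lemma convergent_W_without: "convergent_fps2 (W_without w)"
  unfolding W_without_def by (intro convergent_fps2_prod convergent_fps2_lin convergent_rot v_conv)

lemma map_rot_lin: "map_coeffs (rot w) (lin (rot z v)) = lin (rot (w * z) v)"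
proof -
  interpret comm_ring_hom "rot w" by (rule comm_ring_hom_rot)
  interpret E: comm_ring_hom "map_coeffs (rot w)" by (rule comm_ring_hom_map_coeffs)
  show ?thesis by (simp add: E.h_diff rot_rot)
qed

lemma rot_W: "w \<in> U \<Longrightarrow> map_coeffs (rot w) W = W"
proof -
  assume w: "w \<in> U"
  interpret E: comm_ring_hom "map_coeffs (rot w)"
    by (rule comm_ring_hom.comm_ring_hom_map_coeffs[OF comm_ring_hom_rot])
  show ?thesis
    unfolding W_def E.h_prod map_rot_lin
    by (rule prod.reindex_bij_witness[of _ "\<lambda>z. z / w" "\<lambda>z. w * z"])
       (use w U_nonzero[OF w] U_mult[OF w] U_divide[OF _ w] in auto)
qed

lemma rot_W_without: "w \<in> U \<Longrightarrow> map_coeffs (rot w) (W_without 1) = W_without w"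
proof -
  assume w: "w \<in> U"
  interpret E: comm_ring_hom "map_coeffs (rot w)"
    by (rule comm_ring_hom.comm_ring_hom_map_coeffs[OF comm_ring_hom_rot])
  show ?thesis
    unfolding W_without_def E.h_prod map_rot_lin
    by (rule prod.reindex_bij_witness[of _ "\<lambda>z. z / w" "\<lambda>z. w * z"])
       (use w U_nonzero[OF w] U_mult[OF w] U_divide[OF _ w] in auto)
qed

lemma W_split: "w \<in> U \<Longrightarrow> W = lin (rot w v) * W_without w"
  unfolding W_def W_without_def by (rule prod.remove[OF finite_U])

lemma lin_nonzero: "lin a \<noteq> (0 :: complex fps fps)"
  using arg_cong[of "lin a" 0 "\<lambda>F. fps_nth F 1"] by auto

lemma W_nonzero: "W \<noteq> 0"
  unfolding W_def using finite_U lin_nonzero by auto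

text \<open>Up to the factor \<open>rot w D\<close>, these products are the Lagrange basis for the
  nodes \<open>rot z v\<close>.\<close>

lemma eval_W_without:
  assumes "w \<in> U" "z \<in> U"
  shows "eval_at (W_without w) (rot z v) = (if z = w then rot w D else 0)"
proof (cases "z = w")
  case True
  have "eval_at (map_coeffs (rot w) (W_without 1)) (rot w v) = rot w D"
    unfolding D_def by (rule eval_at_map_coeffs[OF comm_ring_hom_rot v_0 rot_v_0])
  then show ?thesis using True rot_W_without[OF assms(1)] by simp
next
  case False
  have "eval_at (lin (rot z v)) (rot z v) = 0"
    by (simp add: eval_at_diff v_0)
  then have "eval_at (W_without w) (rot z v) = 0"
    unfolding W_without_def eval_at_prod[OF rot_v_0]
    using False assms finite_U by (intro prod_zero bexI[of _ z]) auto
  then show ?thesis using False by simp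
qed

lemma D_prod: "D = (\<Prod>z\<in>U - {1}. v - rot z v)"
  by (simp add: D_def W_without_def eval_at_prod v_0 eval_at_diff)

lemma D_nonzero: "D \<noteq> 0"
  using rot_inj finite_U by (auto simp: D_prod U_def)

text \<open>Each of the n - 1 factors vanishes at t = 0. This makes the natural-number subtraction
  in \<open>conductor_bound\<close> a true one.\<close>

lemma subdegree_D: "n - 1 \<le> subdegree D"
proof -
  have nz: "v - rot z v \<noteq> 0" if "z \<in> U - {1}" for z
    using rot_inj that by (auto simp: U_def)
  then have "subdegree (v - rot z v) \<ge> 1" if "z \<in> U - {1}" for z
    using that v_0 by (auto intro!: subdegree_geI)
  then have "(\<Sum>z\<in>U - {1}. 1) \<le> (\<Sum>z\<in>U - {1}. subdegree (v - rot z v))"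
    by (intro sum_mono) auto
  also have "\<dots> = subdegree D"
    unfolding D_prod using nz by (subst subdegree_prod) auto
  finally show ?thesis using finite_U card_U one_U by simp
qed

lemma lift_inj: "lift g = lift h \<Longrightarrow> g = h"
proof -
  assume eq: "lift g = lift h"
  have "fps_nth (fps_nth (Rep_series2 k) j) i = fps_nth (fps_nth (lift k) j) (n * i)" for k i j
    using n_pos by (simp add: lift_def pull_x_def fps_nth_compose_X_power)
  then have "Rep_series2 g = Rep_series2 h" using eq by (intro fps_ext) metis
  then show ?thesis by (simp add: Rep_series2_inject)
qed

text \<open>Invariance multiplies the coefficient of index k by z^k without changing it; summing
  over all roots of unity kills it unless n divides k.\<close>

lemma descend:
  assumes F: "convergent_fps2 F" and inv: "\<And>z. z \<in> U \<Longrightarrow> map_coeffs (rot z) F = F"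
  obtains g where "lift g = F"
proof -
  define H where "H = Abs_fps (\<lambda>j. Abs_fps (\<lambda>i. fps_nth (fps_nth F j) (n * i)))"
  have "convergent_fps2 H"
    by (rule convergent_fps2_subsample[OF F, of _ 1 n 0]) (simp add: H_def)
  then have H: "Rep_series2 (Abs_series2 H) = H" by (simp add: Abs_series2_inverse)
  have "fps_nth (fps_nth F j) k = 0" if "\<not> n dvd k" for j k
  proof -
    have "fps_nth (fps_nth F j) k = z ^ k * fps_nth (fps_nth F j) k" if "z \<in> U" for z
      using arg_cong[OF inv[OF that], of "\<lambda>F. fps_nth (fps_nth F j) k"] by simp
    then have "(\<Sum>z\<in>U. fps_nth (fps_nth F j) k) = (\<Sum>z\<in>U. z ^ k * fps_nth (fps_nth F j) k)"
      by (intro sum.cong) auto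
    also have "\<dots> = 0"
      using sum_roots_of_unity_power[OF n_pos, of k] that
      by (simp add: U_def flip: sum_distrib_right)
    finally show ?thesis using n_pos by (simp add: card_U)
  qed
  then have "lift (Abs_series2 H) = F"
    using n_pos by (intro fps_ext) (auto simp: lift_def pull_x_def fps_nth_compose_X_power H, auto simp: H_def)
  then show ?thesis by (rule that)
qed

text \<open>The product W is permuted into itself by rotations, hence descends. An h in the kernel
  vanishes at all conjugates of v, so W divides its lift; cancelling W shows that the quotient is
  invariant and descends too.\<close>

lemma kernel_generator:
  obtains g where "lift g = W" "\<And>h. \<pi> h = 0 \<Longrightarrow> g dvd h"
proof -
  obtain g where g: "lift g = W" using descend[OF convergent_W rot_W] by blast
  have "g dvd h" if h: "\<pi> h = 0" for h
  proof -
    have "eval_at (lift h) (rot z v) = 0" if "z \<in> U" for z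
      using that h by (simp add: eval_lift_rot)
    then obtain Q where Q: "convergent_fps2 Q" "lift h = W * Q"
      unfolding W_def using convergent_lift
      by (rule prod_lin_dvd[OF finite_U inj_rot_v rot_v_0, where P = convergent_fps2])
         (auto intro!: convergent_quot_at convergent_rot v_conv simp: v_0)
    have "map_coeffs (rot z) Q = Q" if z: "z \<in> U" for z
    proof -
      interpret E: comm_ring_hom "map_coeffs (rot z)"
        by (rule comm_ring_hom.comm_ring_hom_map_coeffs[OF comm_ring_hom_rot])
      have "W * map_coeffs (rot z) Q = map_coeffs (rot z) (lift h)"
        by (simp add: Q E.h_mult rot_W z)
      also have "\<dots> = W * Q" using lift_rot[OF z, of h] unfolding Q(2) .
      finally show ?thesis using W_nonzero by simp
    qed
    then obtain q where "lift q = Q" using descend[OF Q(1)] by blast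
    then have "h = g * q" by (intro lift_inj) (simp add: Q g lift.h_mult)
    then show ?thesis by simp
  qed
  with g show ?thesis by (rule that)
qed

lemma f_eq:
  obtains g q where "lift g = W" "q dvd 1" "f = g * q"
proof -
  obtain g where g: "lift g = W" "\<And>h. \<pi> h = 0 \<Longrightarrow> g dvd h" using kernel_generator by blast
  then obtain q where q: "f = g * q" using f_zero by (auto simp: \<pi>_def)
  have "eval_at (lin v) v = 0" by (simp add: eval_at_diff v_0)
  then have "\<pi> g = 0"
    using W_split[OF one_U] by (simp add: \<pi>_eq g eval_at_mult v_0 rot_1)
  then have "\<not> g dvd 1" by (metis \<pi>.h_1 \<pi>.h_mult dvdE mult_zero_left zero_neq_one)
  then show ?thesis using that[OF g(1) _ q] branch q Factorial_Ring.irreducibleD by blast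
qed

lemma \<pi>_eq_0_iff: "\<pi> h = 0 \<longleftrightarrow> f dvd h"
proof
  assume h: "\<pi> h = 0"
  obtain g where g: "lift g = W" "\<And>h. \<pi> h = 0 \<Longrightarrow> g dvd h" using kernel_generator by blast
  obtain g' q where f: "lift g' = W" "q dvd 1" "f = g' * q" using f_eq .
  have "g' = g" using f g lift_inj by simp
  then have "g' dvd h" using g h by simp
  moreover obtain r where "1 = q * r" using f(2) by auto
  ultimately show "f dvd h" using f(3)
    by (metis dvdE dvdI mult.assoc mult.commute mult.right_neutral)
next
  assume "f dvd h" then show "\<pi> h = 0" using f_zero by (auto simp: \<pi>.h_mult \<pi>_def[symmetric])
qed

lemma subdegree_unit: "q dvd 1 \<Longrightarrow> subdegree (\<pi> q) = 0"
proof -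
  assume "q dvd 1"
  then obtain r where "1 = q * r" by auto
  then have *: "1 = \<pi> q * \<pi> r" by (metis \<pi>.h_1 \<pi>.h_mult)
  then have "\<pi> q \<noteq> 0" "\<pi> r \<noteq> 0" by auto
  then show ?thesis using arg_cong[OF *, of subdegree] by simp
qed

text \<open>In f = g q the term containing W itself vanishes at v, leaving dW/dY at v, which is D,
  times the restriction of the unit q.\<close>

lemma \<pi>_deriv_y_f: "\<exists>u. subdegree u = 0 \<and> u \<noteq> 0 \<and> \<pi> (deriv_y f) = D * u"
proof -
  obtain g q where f: "lift g = W" "q dvd 1" "f = g * q" using f_eq .
  have 1: "lift (deriv_y h) = fps_deriv (lift h)" for h
    unfolding lift_def by (rule fps_deriv_pull_x[OF X_0, symmetric])
  have X: "eval_at (lin v) v = 0" by (simp add: eval_at_diff v_0)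
  have "W = lin v * W_without 1" using W_split[OF one_U] by (simp add: rot_1)
  then have "eval_at W v = 0" "eval_at (fps_deriv W) v = D"
    by (simp_all add: eval_at_mult eval_at_add v_0 X D_def)
  then have "\<pi> (deriv_y f) = D * \<pi> q"
    by (simp add: \<pi>_eq 1 f lift.h_mult eval_at_add eval_at_mult v_0)
  moreover have "\<pi> q \<noteq> 0" using f(2) by (metis \<pi>.h_1 \<pi>.h_mult dvdE mult_zero_left zero_neq_one)
  ultimately show ?thesis using subdegree_unit[OF f(2)] by blast
qed

lemma subdegree_\<pi>_deriv_y_f: "subdegree (\<pi> (deriv_y f)) = subdegree D"
  using \<pi>_deriv_y_f D_nonzero by auto

text \<open>
  The witness is the trace over \<open>t \<mapsto> z t\<close> of the Lagrange numerator \<open>b * W_without 1\<close>, divided by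
  \<open>n t ^ (n - 1)\<close>: taking the trace keeps exactly the coefficients of index \<open>n i + (n - 1)\<close>.
\<close>

lemma interpolate:
  assumes b: "convergent_fps b"
  obtains g where "of_nat n * fps_X ^ (n - 1) * \<pi> g = b * D"
proof -
  define P where "P = fps_const b * W_without 1"
  have P: "convergent_fps2 P"
    unfolding P_def by (intro convergent_fps2_mult convergent_fps2_fps_const b convergent_W_without)
  define H where "H = Abs_fps (\<lambda>j. Abs_fps (\<lambda>i. fps_nth (fps_nth P j) (n * i + (n - 1))))"
  have "convergent_fps2 H"
    by (rule convergent_fps2_subsample[OF P, of _ 1 n "n - 1"]) (simp add: H_def)
  then have H: "Rep_series2 (Abs_series2 H) = H" by (simp add: Abs_series2_inverse)
  define g where "g = Abs_series2 H"
  \<comment> \<open>The plain sum over \<open>U\<close> would keep the indices divisible by n. The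
    weight z turns z^k into z^(k+1), which selects k = n i + (n - 1), the coefficients stored in
    \<open>H\<close>, each with the factor n.\<close>
  have "fps_const (of_nat n * fps_X ^ (n - 1)) * lift g
      = (\<Sum>z\<in>U. fps_const (fps_const z) * map_coeffs (rot z) P)"
  proof (rule fps_ext, rule fps_ext)
    fix j k
    define a where "a = fps_nth (fps_nth P j) k"
    have "fps_nth (fps_nth (\<Sum>z\<in>U. fps_const (fps_const z) * map_coeffs (rot z) P) j) k
        = (\<Sum>z\<in>U. z ^ (k + 1) * a)"
      by (simp add: fps_sum_nth a_def mult.assoc)
    also have "\<dots> = (if n dvd k + 1 then of_nat n * a else 0)"
      using sum_roots_of_unity_power[OF n_pos, of "k + 1"]
      by (simp add: U_def flip: sum_distrib_right)
    also have "\<dots> = fps_nth (fps_nth (fps_const (of_nat n * fps_X ^ (n - 1)) * lift g) j) k"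
    proof -
      have "fps_nth (fps_nth (fps_const (of_nat n * fps_X ^ (n - 1)) * lift g) j) k
         = of_nat n * (if k < n - 1 then 0 else fps_nth (fps_nth (lift g) j) (k - (n - 1)))"
        by (simp add: fps_of_nat[symmetric] mult.assoc fps_X_power_mult_nth)
      also have "\<dots> = (if n dvd k + 1 then of_nat n * a else 0)"
      proof (cases "n dvd k + 1")
        case True
        then obtain m where m: "k + 1 = n * m" by auto
        then obtain m' where m': "m = Suc m'" by (cases m) auto
        have k: "k = n * m' + (n - 1)" using m m' n_pos by (simp add: algebra_simps)
        then have "k - (n - 1) = n * m'" by simp
        then show ?thesis using True k n_pos
          by (simp add: lift_def pull_x_def fps_nth_compose_X_power g_def H a_def) (simp add: H_def)
      next
        case False
        have "\<not> n dvd k - (n - 1)" if "\<not> k < n - 1"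
        proof
          assume "n dvd k - (n - 1)"
          then have "n dvd k - (n - 1) + n" by simp
          also have "k - (n - 1) + n = k + 1" using that n_pos by simp
          finally show False using False by simp
        qed
        then show ?thesis using False
          by (auto simp: lift_def pull_x_def fps_nth_compose_X_power)
      qed
      finally show ?thesis by simp
    qed
    finally show "fps_nth (fps_nth (fps_const (of_nat n * fps_X ^ (n - 1)) * lift g) j) k
      = fps_nth (fps_nth (\<Sum>z\<in>U. fps_const (fps_const z) * map_coeffs (rot z) P) j) k" by simp
  qed
  moreover have "map_coeffs (rot z) P = fps_const (rot z b) * W_without z" if z: "z \<in> U" for z
  proof -
    interpret comm_ring_hom "rot z" by (rule comm_ring_hom_rot)
    interpret E: comm_ring_hom "map_coeffs (rot z)" by (rule comm_ring_hom_map_coeffs)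
    show ?thesis by (simp add: P_def E.h_mult rot_W_without[OF z])
  qed
  ultimately have "fps_const (of_nat n * fps_X ^ (n - 1)) * lift g
      = (\<Sum>z\<in>U. fps_const (fps_const z) * (fps_const (rot z b) * W_without z))"
    by simp
  then have "eval_at (fps_const (of_nat n * fps_X ^ (n - 1)) * lift g) v
      = eval_at (\<Sum>z\<in>U. fps_const (fps_const z) * (fps_const (rot z b) * W_without z)) v"
    by simp
  then have "of_nat n * fps_X ^ (n - 1) * \<pi> g
      = (\<Sum>z\<in>U. fps_const z * (rot z b * eval_at (W_without z) v))"
    by (simp only: eval_at_mult[OF v_0] eval_at_sum[OF v_0] eval_at_const[OF v_0] \<pi>_eq)
  also have "\<dots> = (\<Sum>z\<in>U. if z = 1 then b * D else 0)"
    using eval_W_without[OF _ one_U] by (intro sum.cong) (auto simp: rot_1)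
  also have "\<dots> = b * D" using finite_U one_U by simp
  finally show ?thesis by (rule that)
qed

lemma conductor_gap:
  assumes g: "\<pi> g \<noteq> 0"
  shows "subdegree (\<pi> g) + n \<noteq> subdegree D"
proof
  assume eq: "subdegree (\<pi> g) + n = subdegree D"
  define u where "u = fps_X ^ n * \<pi> g / D"
  have sd: "subdegree (fps_X ^ n * \<pi> g) = subdegree D" using eq g by simp
  then have "D dvd fps_X ^ n * \<pi> g" using D_nonzero by (simp add: fps_dvd_iff g)
  then have uD: "u * D = fps_X ^ n * \<pi> g" by (simp add: u_def)
  then have "u \<noteq> 0" using g by auto
  then have "subdegree u = 0"
    using arg_cong[OF uD, of subdegree] sd D_nonzero by simp
  then have u0: "fps_nth u 0 \<noteq> 0" using \<open>u \<noteq> 0\<close> nth_subdegree_nonzero by fastforce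
  \<comment> \<open>The subtracted sum is the Lagrange interpolant of t^n g: at the node
    \<open>rot w v\<close> it takes the value \<open>rot w (u * D)\<close>, which is t^n times the
    conjugate of \<open>\<pi> g\<close>. By the choice of orders u is a unit.\<close>
  define F where "F = fps_const (fps_X ^ n) * lift g - (\<Sum>z\<in>U. fps_const (rot z u) * W_without z)"
  have "eval_at F (rot w v) = 0" if w: "w \<in> U" for w
  proof -
    interpret comm_ring_hom "rot w" by (rule comm_ring_hom_rot)
    have "(\<Sum>z\<in>U. rot z u * eval_at (W_without z) (rot w v)) = (\<Sum>z\<in>U. if z = w then rot w u * rot w D else 0)"
      using w by (intro sum.cong) (auto simp: eval_W_without)
    then have "eval_at F (rot w v) = fps_X ^ n * rot w (\<pi> g) - rot w u * rot w D"
      using w finite_U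
      by (simp add: F_def eval_at_diff eval_at_sum eval_at_mult v_0 eval_lift_rot)
    also have "\<dots> = rot w (fps_X ^ n * \<pi> g) - rot w (u * D)"
      using w by (simp add: h_mult rot_X_power)
    finally show ?thesis using uD by simp
  qed
  then obtain Q where Q: "F = W * Q"
    unfolding W_def
    by (rule prod_lin_dvd[OF finite_U inj_rot_v rot_v_0, where P = "\<lambda>_. True"]) auto
  \<comment> \<open>At \<open>t = 0\<close> all the \<open>rot z v\<close> vanish, so \<open>W\<close> becomes \<open>Y ^ n\<close> and \<open>W_without z\<close> becomes \<open>Y ^ (n - 1)\<close>.\<close>
  interpret h: comm_ring_hom "\<lambda>a :: complex fps. fps_nth a 0" by standard auto
  interpret E: comm_ring_hom "map_coeffs (\<lambda>a :: complex fps. fps_nth a 0)"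
    by (rule h.comm_ring_hom_map_coeffs)
  have l: "map_coeffs (\<lambda>a. fps_nth a 0) (lin (rot z v)) = fps_X" for z
    by (simp add: E.h_diff v_0)
  have W0: "map_coeffs (\<lambda>a. fps_nth a 0) W = fps_X ^ n"
    by (simp add: W_def E.h_prod l card_U)
  have W1: "map_coeffs (\<lambda>a. fps_nth a 0) (W_without z) = fps_X ^ (n - 1)" if "z \<in> U" for z
    using that finite_U by (simp add: W_without_def E.h_prod l card_U)
  have "map_coeffs (\<lambda>a. fps_nth a 0) F = - (of_nat n * fps_const (fps_nth u 0) * fps_X ^ (n - 1))"
    using n_pos by (simp add: F_def E.h_diff E.h_mult E.h_sum W1 card_U)
  then have "- (of_nat n * fps_const (fps_nth u 0) * fps_X ^ (n - 1))
      = fps_X ^ n * map_coeffs (\<lambda>a. fps_nth a 0) Q"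
    by (simp add: Q E.h_mult W0)
  \<comment> \<open>The coefficient of Y^(n-1) is - n u(0), nonzero, on the left and 0 on the
    right.\<close>
  from arg_cong[OF this, of "\<lambda>F. fps_nth F (n - 1)"] show False
    using n_pos u0 by (simp add: fps_X_power_mult_nth fps_of_nat[symmetric] fps_X_power_mult_right_nth)
qed

end

section \<open>Intersection multiplicity as order along the curve, and the conductor\<close>

lemma ring_of_type_algebra_simps [simp]:
  "carrier ring_of_type_algebra = UNIV"
  "x \<oplus>\<^bsub>ring_of_type_algebra\<^esub> y = x + y"
  "x \<otimes>\<^bsub>ring_of_type_algebra\<^esub> y = x * y"
  "\<zero>\<^bsub>ring_of_type_algebra\<^esub> = 0"
  "\<one>\<^bsub>ring_of_type_algebra\<^esub> = 1"
  by (simp_all add: ring_of_type_algebra_def)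

lemma genideal_pair:
  "genideal series2_ring {f, g} = {a * f + b * g | a b. True}"
proof -
  interpret R: cring series2_ring by (rule cring_from_type_algebra)
  let ?I = "genideal series2_ring {f, g}"
  have sum: "{a * f + b * g | a b. True}
      = (cgenideal series2_ring f) <+>\<^bsub>series2_ring\<^esub> (cgenideal series2_ring g)"
    by (auto simp: set_add_def' cgenideal_def)
  have "ideal {a * f + b * g | a b. True} series2_ring"
    unfolding sum by (intro R.add_ideals R.cgenideal_ideal) auto
  moreover have "{f, g} \<subseteq> {a * f + b * g | a b. True}"
  proof -
    have "f = 1 * f + 0 * g" "g = 0 * f + 1 * g" by simp_all
    then show ?thesis by blast
  qed
  ultimately have 1: "?I \<subseteq> {a * f + b * g | a b. True}" by (rule R.genideal_minimal)
  interpret I: ideal ?I series2_ring by (rule R.genideal_ideal) simp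
  have "f \<in> ?I" "g \<in> ?I" using R.genideal_self[of "{f, g}"] by auto
  then have "a * f + b * g \<in> ?I" for a b
    using I.I_l_closed[of f a] I.I_l_closed[of g b] I.a_closed[of "a * f" "b * g"] by simp
  then show ?thesis using 1 by blast
qed

text \<open>No vector lies outside the zero space, so no extension step can occur. This serves the
  case of a zero quotient, where the constants do not form a field.\<close>

lemma (in ring) dimension_trivial:
  assumes "dimension m K E" "carrier R = {\<zero>}"
  shows "m = 0 \<and> E = {\<zero>}"
  using assms by (induction rule: dimension.induct) auto

context branch_normal_form
begin

lemma \<pi>_const: "\<pi> (const2 c) = fps_const c"
proof -
  have "lift (const2 c) = fps_const (fps_const c)"
    by (rule fps_ext) (simp add: lift_def pull_x_def const2.rep_eq fps_const_compose)
  then show ?thesis by (simp add: \<pi>_eq v_0)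
qed

definition orders :: "nat set" where
  "orders = {subdegree (\<pi> g) | g. \<pi> g \<noteq> 0}"

definition conductor_bound :: nat where "conductor_bound = subdegree D - (n - 1)"

lemma orders_ge: "p \<ge> conductor_bound \<Longrightarrow> p \<in> orders"
proof -
  assume p: "p \<ge> conductor_bound"
  obtain g where g: "of_nat n * fps_X ^ (n - 1) * \<pi> g = fps_X ^ (p - conductor_bound) * D"
    using interpolate[OF convergent_fps_power[OF convergent_fps_X]] by blast
  have nz: "\<pi> g \<noteq> 0" using g D_nonzero by auto
  have "subdegree (of_nat n :: complex fps) = 0" by (simp flip: fps_of_nat)
  then have "(n - 1) + subdegree (\<pi> g) = (p - conductor_bound) + subdegree D"
    using arg_cong[OF g, of subdegree] nz D_nonzero n_pos by simp
  then have "subdegree (\<pi> g) = p" using p subdegree_D by (simp add: conductor_bound_def)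
  then show ?thesis using nz by (auto simp: orders_def)
qed

text \<open>The premise amounts to p + n = ord D, the order excluded by
  \<open>conductor_gap\<close>; written with p + 1, it is void for bound 0.\<close>

lemma conductor_bound_gap: "p + 1 = conductor_bound \<Longrightarrow> p \<notin> orders"
  using conductor_gap subdegree_D n_pos by (force simp: orders_def conductor_bound_def)

lemma convergent_\<pi>: "convergent_fps (\<pi> g)"
  unfolding \<pi>_def by (intro convergent_subst2_X_power n_pos v_conv v_0)

lemma convergent_D: "convergent_fps D"
  unfolding D_def by (intro convergent_eval_at convergent_W_without v_conv v_0)

text \<open>This is stronger than attaining all large orders: each convergent series of large order
  is itself a restriction. The case c = 0 is separate because
  \<open>subdegree 0 = 0\<close>.\<close>

lemma \<pi>_surj:
  assumes c: "convergent_fps c" "c = 0 \<or> subdegree c \<ge> conductor_bound"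
  obtains g where "\<pi> g = c"
proof (cases "c = 0")
  case True then show ?thesis using that[of 0] \<pi>.h_0 by simp
next
  case False
  \<comment> \<open>Interpolating n b cancels the factor n t^(n-1); the order of c makes the
    division by D exact.\<close>
  define b where "b = fps_X ^ (n - 1) * c / D"
  have sd: "subdegree D \<le> subdegree (fps_X ^ (n - 1) * c)"
    using c False subdegree_D by (simp add: conductor_bound_def)
  have "convergent_fps b"
    unfolding b_def
    by (intro convergent_fps_divide convergent_fps_mult convergent_fps_power convergent_fps_X c
        convergent_D D_nonzero sd)
  moreover have "D dvd fps_X ^ (n - 1) * c" using sd D_nonzero False by (simp add: fps_dvd_iff)
  then have bD: "b * D = fps_X ^ (n - 1) * c" by (simp add: b_def)
  ultimately obtain g where g: "of_nat n * fps_X ^ (n - 1) * \<pi> g = of_nat n * b * D"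
    using interpolate[of "of_nat n * b"] convergent_fps_mult[OF convergent_fps_const[of "of_nat n"], of b]
    by (auto simp: fps_of_nat)
  also have "of_nat n * b * D = of_nat n * fps_X ^ (n - 1) * c" by (simp add: bD mult.assoc)
  finally have "\<pi> g = c" using n_pos by simp
  then show ?thesis by (rule that)
qed

lemma dvd_of_order:
  assumes g: "\<pi> g \<noteq> 0" and h: "\<And>i. i < conductor_bound + subdegree (\<pi> g) \<Longrightarrow> fps_nth (\<pi> h) i = 0"
  obtains k where "\<pi> h = \<pi> g * \<pi> k"
proof (cases "\<pi> h = 0")
  case True then show ?thesis using that[of 0] by (simp add: \<pi>.h_0)
next
  case False
  have sd: "conductor_bound + subdegree (\<pi> g) \<le> subdegree (\<pi> h)" using h False by (intro subdegree_geI) auto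
  then have "\<pi> g dvd \<pi> h" using g False by (simp add: fps_dvd_iff)
  then have eq: "\<pi> h = \<pi> g * (\<pi> h / \<pi> g)" by simp
  have "\<pi> h / \<pi> g \<noteq> 0" using eq False by auto
  then have "subdegree (\<pi> h) = subdegree (\<pi> g) + subdegree (\<pi> h / \<pi> g)"
    using g arg_cong[OF eq, of subdegree] by simp
  then have "conductor_bound \<le> subdegree (\<pi> h / \<pi> g)" using sd by simp
  moreover have "convergent_fps (\<pi> h / \<pi> g)"
    using sd by (intro convergent_fps_divide convergent_\<pi> g) auto
  ultimately obtain k where "\<pi> k = \<pi> h / \<pi> g" using \<pi>_surj by blast
  then show ?thesis using that eq by metis
qed

text \<open>The Apery set of the semigroup \<open>orders\<close> with respect to
  \<open>d\<close>.\<close>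

definition new_orders :: "nat \<Rightarrow> nat set" where
  "new_orders d = {p \<in> orders. \<nexists>s. s \<in> orders \<and> p = s + d}"

text \<open>Below \<open>conductor_bound + d\<close> there are \<open>card ?A + d\<close> orders,
  and exactly \<open>card ?A\<close> of them are shifts by d of orders.\<close>

lemma card_new_orders:
  assumes d: "\<And>s. s \<in> orders \<Longrightarrow> s + d \<in> orders"
  shows "new_orders d \<subseteq> {..<conductor_bound + d}" "card (new_orders d) = d"
proof -
  let ?A = "orders \<inter> {..<conductor_bound}"
  have V: "orders \<inter> {..<conductor_bound + d} = ?A \<union> {conductor_bound..<conductor_bound + d}"
    using orders_ge by auto
  have "\<exists>s. s \<in> orders \<and> p = s + d" if "p \<ge> conductor_bound + d" for p
    using that orders_ge[of "p - d"] by (intro exI[of _ "p - d"]) auto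
  then have N: "new_orders d = orders \<inter> {..<conductor_bound + d} - (\<lambda>s. s + d) ` ?A"
    by (auto simp: new_orders_def not_less[symmetric])
  then show "new_orders d \<subseteq> {..<conductor_bound + d}" by auto
  have "card (new_orders d) = card (orders \<inter> {..<conductor_bound + d}) - card ((\<lambda>s. s + d) ` ?A)"
    unfolding N using d by (intro card_Diff_subset) auto
  also have "card ((\<lambda>s. s + d) ` ?A) = card ?A" by (intro card_image) auto
  also have "card (orders \<inter> {..<conductor_bound + d}) = card ?A + d"
    unfolding V by (subst card_Un_disjoint) auto
  finally show "card (new_orders d) = d" by simp
qed

text \<open>Since the kernel of \<pi> is (f), the quotient by (f, g) is the image of \<pi> modulo
  the multiples of \<open>\<pi> g\<close> there. Its dimension is the number of orders that are not
  orders of such multiples, that is, the size d of the Apery set.\<close>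

lemma intersection_mult_eq:
  assumes g: "\<pi> g \<noteq> 0"
  shows "intersection_mult f g = subdegree (\<pi> g)"
proof -
  define d where "d = subdegree (\<pi> g)"
  define I where "I = genideal series2_ring {f, g}"
  define Q where "Q = series2_ring Quot I"
  define q where "q h = I +>\<^bsub>series2_ring\<^esub> h" for h
  define K where "K = range (\<lambda>c. q (const2 c))"
  interpret R: cring series2_ring by (rule cring_from_type_algebra)
  interpret I: ideal I series2_ring unfolding I_def by (rule R.genideal_ideal) simp
  have q_eq: "q = (+>\<^bsub>series2_ring\<^esub>) I" by (rule ext) (simp add: q_def)
  interpret Q: ring Q unfolding Q_def by (rule I.quotient_is_ring)
  interpret q: ring_hom_ring series2_ring Q q
    unfolding Q_def q_eq by (rule I.rcos_ring_hom_ring)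
  have f0: "\<pi> f = 0" using f_zero by (simp add: \<pi>_def)
  have I_iff: "h \<in> I \<longleftrightarrow> (\<exists>k. \<pi> h = \<pi> g * \<pi> k)" for h
  proof
    assume "h \<in> I"
    then obtain a b where "h = a * f + b * g" by (auto simp: I_def genideal_pair)
    then have "\<pi> h = \<pi> g * \<pi> b" by (simp add: \<pi>.h_add \<pi>.h_mult f0)
    then show "\<exists>k. \<pi> h = \<pi> g * \<pi> k" by blast
  next
    assume "\<exists>k. \<pi> h = \<pi> g * \<pi> k"
    then obtain k where "\<pi> (h - g * k) = 0" by (auto simp: \<pi>.h_diff \<pi>.h_mult)
    then obtain a where "h - g * k = f * a" using \<pi>_eq_0_iff by auto
    then have "h = a * f + k * g" by (simp add: algebra_simps)
    then show "h \<in> I" by (auto simp: I_def genideal_pair)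
  qed
  have q_eq_iff: "q a = q b \<longleftrightarrow> a - b \<in> I" for a b
  proof
    assume "q a = q b"
    moreover have "a \<in> q a" unfolding q_def using I.zero_closed by (force simp: a_r_coset_def')
    ultimately show "a - b \<in> I" by (auto simp: q_def a_r_coset_def')
  next
    assume "a - b \<in> I"
    then have "q (a - b) = \<zero>\<^bsub>Q\<^esub>"
      unfolding q_def Q_def using R.a_rcos_zero[OF I.is_ideal] by (simp add: FactRing_def)
    moreover have "q a = q (a - b) \<oplus>\<^bsub>Q\<^esub> q b" using q.hom_add[of "a - b" b] by simp
    moreover have "q b \<in> carrier Q" using q.hom_closed[of b] by simp
    ultimately show "q a = q b" by simp
  qed
  have carrier_Q: "carrier Q = range q"
    by (auto simp: Q_def FactRing_def A_RCOSETS_def' q_def)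
  have q_0: "q 0 = \<zero>\<^bsub>Q\<^esub>" using q.hom_zero by simp
  have q_lin: "q (const2 c) \<otimes>\<^bsub>Q\<^esub> q a \<oplus>\<^bsub>Q\<^esub> q b = q (const2 c * a + b)" for a b c
    using q.hom_add[of "const2 c * a" b] q.hom_mult[of "const2 c" a] by simp

  \<comment> \<open>Filter the quotient by the order along the curve: a step of the filtration has dimension one
    if its order is not already the order of a multiple of \<open>g\<close>, and zero otherwise.\<close>
  define E where "E p = q ` {h. \<forall>i<p. fps_nth (\<pi> h) i = 0}" for p
  have orders_d: "s + d \<in> orders" if "s \<in> orders" for s
  proof -
    from that obtain k where "\<pi> k \<noteq> 0" "s = subdegree (\<pi> k)" by (auto simp: orders_def)
    then have "\<pi> (k * g) \<noteq> 0" "s + d = subdegree (\<pi> (k * g))"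
      using g by (auto simp: \<pi>.h_mult d_def)
    then show ?thesis by (auto simp: orders_def)
  qed
  note card_new = card_new_orders[OF orders_d]
  have E_top: "E (conductor_bound + d) = {\<zero>\<^bsub>Q\<^esub>}"
  proof -
    have "q h = q 0" if h: "\<forall>i<conductor_bound + d. fps_nth (\<pi> h) i = 0" for h
    proof -
      obtain k where "\<pi> h = \<pi> g * \<pi> k"
        using dvd_of_order[OF g, of h] h unfolding d_def by blast
      then show ?thesis by (auto simp: q_eq_iff I_iff)
    qed
    moreover have "0 \<in> {h. \<forall>i<conductor_bound + d. fps_nth (\<pi> h) i = 0}" by (simp add: \<pi>.h_0)
    ultimately show ?thesis unfolding E_def q_0[symmetric] by blast
  qed
  have E_step_old: "E p = E (Suc p)" if p: "p \<notin> new_orders d" for p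
  proof -
    have "q h \<in> E (Suc p)" if h: "\<forall>i<p. fps_nth (\<pi> h) i = 0" for h
    proof (cases "fps_nth (\<pi> h) p = 0")
      case True then show ?thesis using h by (auto simp: E_def less_Suc_eq)
    next
      case False
      then have "subdegree (\<pi> h) = p" "\<pi> h \<noteq> 0" using h by (auto intro: subdegreeI)
      then have "p \<in> orders" by (auto simp: orders_def)
      then obtain k where k: "\<pi> k \<noteq> 0" "p = subdegree (\<pi> k) + d"
        using p by (auto simp: new_orders_def orders_def)
      \<comment> \<open>As p is the order of a multiple of g, subtracting a constant times this
        multiple removes the leading coefficient of \<open>\<pi> h\<close> without changing the
        class.\<close>
      define e where "e = \<pi> g * \<pi> k"
      have e: "e \<noteq> 0" "subdegree e = p" using k g by (auto simp: e_def d_def)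
      define c where "c = fps_nth (\<pi> h) p / fps_nth e p"
      have ep: "fps_nth e p \<noteq> 0" using e by (metis nth_subdegree_nonzero)
      define h' where "h' = h - const2 c * g * k"
      have h': "\<pi> h' = \<pi> h - fps_const c * e"
        by (simp add: h'_def \<pi>.h_diff \<pi>.h_mult \<pi>_const e_def mult.assoc)
      have "fps_nth (\<pi> h') i = 0" if "i < Suc p" for i
      proof (cases "i = p")
        case True then show ?thesis using ep by (simp add: h' c_def)
      next
        case False
        then have "i < p" using that by simp
        then show ?thesis using h nth_less_subdegree_zero[of i e] e(2) by (simp add: h')
      qed
      moreover have "\<pi> (h - h') = \<pi> g * \<pi> (const2 c * k)"
        by (simp add: h'_def \<pi>.h_mult)
      then have "q h = q h'" unfolding q_eq_iff I_iff by blast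
      ultimately show ?thesis by (auto simp: E_def)
    qed
    then have "E p \<subseteq> E (Suc p)" by (auto simp: E_def)
    moreover have "E (Suc p) \<subseteq> E p" by (auto simp: E_def)
    ultimately show ?thesis by blast
  qed
  have E_step_new: "\<exists>u. q u \<notin> E (Suc p) \<and> E p = Q.line_extension K (q u) (E (Suc p))"
    if p: "p \<in> new_orders d" for p
  proof -
    obtain u where u: "\<pi> u \<noteq> 0" "p = subdegree (\<pi> u)"
      using p by (auto simp: new_orders_def orders_def)
    have up: "fps_nth (\<pi> u) p \<noteq> 0" using u by simp
    have ui: "fps_nth (\<pi> u) i = 0" if "i < p" for i
      using that u nth_less_subdegree_zero by blast
    \<comment> \<open>Otherwise u would differ from a series of larger order by an element of (f,
      g), and p would be the order of a multiple of g.\<close>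
    have "q u \<notin> E (Suc p)"
    proof
      assume "q u \<in> E (Suc p)"
      then obtain h where h: "q u = q h" "\<forall>i<Suc p. fps_nth (\<pi> h) i = 0" by (auto simp: E_def)
      then obtain k where k: "\<pi> (u - h) = \<pi> g * \<pi> k" by (auto simp: q_eq_iff I_iff)
      have "subdegree (\<pi> (u - h)) = p"
        using h(2) up ui by (intro subdegreeI) (auto simp: \<pi>.h_diff)
      moreover have nz: "\<pi> k \<noteq> 0"
        using k h(2) up by (metis \<pi>.h_diff diff_zero fps_sub_nth fps_zero_nth lessI mult_zero_right)
      ultimately have "p = subdegree (\<pi> k) + d" using k g by (simp add: d_def)
      then show False using p nz by (auto simp: new_orders_def orders_def)
    qed
    moreover have "E p = Q.line_extension K (q u) (E (Suc p))"
    proof (rule Set.set_eqI)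
      fix a
      have "a \<in> E p \<longleftrightarrow> (\<exists>c h. (\<forall>i<Suc p. fps_nth (\<pi> h) i = 0) \<and> a = q (const2 c * u + h))"
      proof
        assume "a \<in> E p"
        then obtain h where h: "a = q h" "\<forall>i<p. fps_nth (\<pi> h) i = 0" by (auto simp: E_def)
        define c where "c = fps_nth (\<pi> h) p / fps_nth (\<pi> u) p"
        have "fps_nth (\<pi> (h - const2 c * u)) i = 0" if "i < Suc p" for i
          using that h up ui by (cases "i = p") (auto simp: \<pi>.h_diff \<pi>.h_mult \<pi>_const c_def)
        then show "\<exists>c h. (\<forall>i<Suc p. fps_nth (\<pi> h) i = 0) \<and> a = q (const2 c * u + h)"
          using h by (intro exI[of _ c] exI[of _ "h - const2 c * u"]) auto
      next
        assume "\<exists>c h. (\<forall>i<Suc p. fps_nth (\<pi> h) i = 0) \<and> a = q (const2 c * u + h)"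
        then obtain c h where h: "\<forall>i<Suc p. fps_nth (\<pi> h) i = 0" "a = q (const2 c * u + h)" by blast
        then have "\<forall>i<p. fps_nth (\<pi> (const2 c * u + h)) i = 0"
          using ui by (auto simp: \<pi>.h_add \<pi>.h_mult \<pi>_const)
        then show "a \<in> E p" using h(2) by (auto simp: E_def)
      qed
      also have "\<dots> \<longleftrightarrow> a \<in> Q.line_extension K (q u) (E (Suc p))"
        unfolding Q.line_extension_mem_iff K_def E_def by (auto simp: q_lin)
      finally show "a \<in> E p \<longleftrightarrow> a \<in> Q.line_extension K (q u) (E (Suc p))" .
    qed
    ultimately show ?thesis by blast
  qed
  have "Q.dimension (card (new_orders d \<inter> {p..})) K (E p)" if "p \<le> conductor_bound + d" for p
    using that
  proof (induction rule: inc_induct)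
    case base
    have "new_orders d \<inter> {conductor_bound + d..} = {}" using card_new(1) by auto
    then show ?case by (simp add: E_top)
  next
    case (step p)
    show ?case
    proof (cases "p \<in> new_orders d")
      case True
      obtain u where u: "q u \<notin> E (Suc p)" "E p = Q.line_extension K (q u) (E (Suc p))"
        using E_step_new[OF True] by blast
      have "new_orders d \<inter> {p..} = insert p (new_orders d \<inter> {Suc p..})"
        using True by (auto simp: Suc_le_eq)
      moreover have "finite (new_orders d \<inter> {Suc p..})"
        using card_new(1) finite_subset by blast
      ultimately have "card (new_orders d \<inter> {p..}) = Suc (card (new_orders d \<inter> {Suc p..}))" by simp
      then show ?thesis
        unfolding u(2) using u(1) step.IH carrier_Q by (auto intro: Q.dimension.Suc_dim)
    next
      case False
      then have "new_orders d \<inter> {p..} = new_orders d \<inter> {Suc p..}"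
        by (auto simp: Suc_le_eq le_less)
      then show ?thesis using step.IH E_step_old[OF False] by simp
    qed
  qed
  from this[of 0] have dim: "Q.dimension d K (carrier Q)"
    by (simp add: card_new(2) E_def carrier_Q atLeast_0)
  \<comment> \<open>\<open>dim\<close> is a definite description, so uniqueness is needed too; the
    library argument for it requires a field of scalars, hence a nonzero quotient.\<close>
  have uniq: "m = d" if m: "Q.dimension m K (carrier Q)" for m
  proof (cases "\<one>\<^bsub>Q\<^esub> = \<zero>\<^bsub>Q\<^esub>")
    case True
    then have "carrier Q = {\<zero>\<^bsub>Q\<^esub>}" by (rule Q.one_zeroD)
    then show ?thesis using Q.dimension_trivial[OF m] Q.dimension_trivial[OF dim] by simp
  next
    case False
    interpret C: field "ring_of_type_algebra :: complex ring" by (rule field_from_type_algebra)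
    have 1: "const2 1 = 1" "const2 (a + b) = const2 a + const2 b" "const2 (a * b) = const2 a * const2 b" for a b
      by (transfer, simp)+
    have "ring_hom_ring (ring_of_type_algebra :: complex ring) Q (\<lambda>c. q (const2 c))"
    proof (rule ring_hom_ringI)
      show "ring (ring_of_type_algebra :: complex ring)" by (rule C.ring_axioms)
      show "ring Q" by (rule Q.ring_axioms)
    qed (use q.hom_add q.hom_mult q.hom_one q.hom_closed in \<open>auto simp: 1\<close>)
    then interpret h: ring_hom_ring "ring_of_type_algebra :: complex ring" Q "\<lambda>c. q (const2 c)" .
    have "subfield K Q"
      using h.img_is_subfield(2)[OF C.carrier_is_subfield False] by (simp add: K_def)
    then show ?thesis using Q.dimension_is_inj[OF _ m dim] by simp
  qed
  have "Q.dim K (carrier Q) = d"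
    unfolding Q.dim_def using dim uniq by (rule the_equality)
  then show ?thesis
    unfolding intersection_mult_def Let_def Q_def I_def K_def q_def d_def .
qed

lemma branch_semigroup_eq: "branch_semigroup f = orders"
  unfolding branch_semigroup_def orders_def
  using intersection_mult_eq \<pi>_eq_0_iff by (intro Collect_cong) metis

lemma conductor_eq: "conductor f = conductor_bound"
  unfolding conductor_def branch_semigroup_eq
proof (rule Least_equality)
  show "conductor_bound \<in> orders \<and> (\<forall>p\<ge>conductor_bound. p \<in> orders)" using orders_ge by blast
next
  fix c assume c: "c \<in> orders \<and> (\<forall>p\<ge>c. p \<in> orders)"
  show "conductor_bound \<le> c"
  proof (rule ccontr)
    assume "\<not> conductor_bound \<le> c"
    then have "conductor_bound - 1 \<ge> c" "conductor_bound - 1 + 1 = conductor_bound" by auto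
    then show False using conductor_bound_gap[of "conductor_bound - 1"] c by blast
  qed
qed

end

section \<open>Reduction to the normal form and comparison of orders\<close>

lemma subdegree_fps_deriv:
  fixes u :: "complex fps"
  assumes "subdegree u > 0"
  shows "subdegree (fps_deriv u) = subdegree u - 1" "fps_deriv u \<noteq> 0"
proof -
  have u: "u \<noteq> 0" using assms by auto
  have nz: "fps_nth (fps_deriv u) (subdegree u - 1) \<noteq> 0"
    using assms u by (simp del: of_nat_Suc)
  show "fps_deriv u \<noteq> 0" using nz by (metis fps_zero_nth)
  have "fps_nth (fps_deriv u) i = 0" if "i < subdegree u - 1" for i
  proof -
    have "fps_nth u (i + 1) = 0" using that by (intro nth_less_subdegree_zero) auto
    then show ?thesis by simp
  qed
  then show "subdegree (fps_deriv u) = subdegree u - 1" using nz by (intro subdegreeI) auto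
qed

lemma root_of_unity_minimal_order:
  fixes z :: complex
  assumes "z ^ n = 1" "n > 0" "z \<noteq> 1"
  obtains d where "d \<ge> 2" "\<And>m. z ^ m = 1 \<Longrightarrow> d dvd m"
proof -
  define d where "d = (LEAST d. d > 0 \<and> z ^ d = 1)"
  have d: "d > 0" "z ^ d = 1"
    using LeastI[of "\<lambda>d. d > 0 \<and> z ^ d = 1" n] assms by (auto simp: d_def)
  have least: "d \<le> k" if "k > 0" "z ^ k = 1" for k
    unfolding d_def using that by (intro Least_le) auto
  show ?thesis
  proof (rule that[of d])
    show "d \<ge> 2" using d assms(3) by (cases "d = 1") auto
    fix m assume m: "z ^ m = 1"
    have "z ^ m = (z ^ d) ^ (m div d) * z ^ (m mod d)"
      by (simp flip: power_mult power_add)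
    then have "z ^ (m mod d) = 1" using m d by simp
    then have "m mod d = 0" using least[of "m mod d"] d(1) mod_less_divisor[of d m] by linarith
    then show "d dvd m" by auto
  qed
qed

text \<open>Take \<tau> to be an n-th root of x and express y through \<tau>. If a rotation by z of
  exact order d >= 2 fixed v, then v would be a series in t^d; as d divides n, both coordinates
  would be series in \<tau>^d, of order d, against irreducibility.\<close>

lemma irreducible_parametrization_normal_form:
  assumes p: "irreducible_parametrization f x y" and x: "x \<noteq> 0"
  obtains v \<tau> where "convergent_fps v" "fps_nth v 0 = 0" "fps_nth \<tau> 0 = 0" "subdegree \<tau> = 1"
    "x = fps_X ^ subdegree x oo \<tau>" "y = v oo \<tau>"
    "\<And>z. z ^ subdegree x = 1 \<Longrightarrow> rot z v = v \<Longrightarrow> z = 1"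
proof -
  define n where "n = subdegree x"
  from p have xy: "convergent_fps x" "convergent_fps y" "fps_nth x 0 = 0" "fps_nth y 0 = 0"
    by (auto simp: irreducible_parametrization_def parametrization_def)
  have n: "n > 0" using x xy(3) unfolding n_def by (metis gr0I nth_subdegree_nonzero)
  obtain \<tau> where \<tau>: "convergent_fps \<tau>" "fps_nth \<tau> 0 = 0" "fps_nth \<tau> 1 \<noteq> 0" "\<tau> ^ n = x"
    using convergent_fps_root[OF xy(1) n_def[symmetric] n] by blast
  obtain \<rho> where \<rho>: "convergent_fps \<rho>" "fps_nth \<rho> 0 = 0" "\<rho> oo \<tau> = fps_X"
    using convergent_fps_left_inverse[OF \<tau>(1-3)] by blast
  define v where "v = y oo \<rho>"
  have v: "convergent_fps v" unfolding v_def by (intro convergent_fps_compose xy \<rho>)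
  have y: "y = v oo \<tau>"
    by (simp add: v_def fps_compose_assoc[OF \<tau>(2) \<rho>(2), symmetric] \<rho>(3))
  have st: "subdegree \<tau> = 1" using \<tau>(2,3) by (intro subdegreeI) auto
  have "z = 1" if z: "z ^ n = 1" "rot z v = v" for z
  proof (rule ccontr)
    assume "z \<noteq> 1"
    then obtain d where d: "d \<ge> 2" "\<And>m. z ^ m = 1 \<Longrightarrow> d dvd m"
      using root_of_unity_minimal_order[OF z(1) n] by blast
    define w where "w = Abs_fps (\<lambda>i. fps_nth v (d * i))"
    have "fps_nth v m = 0" if "\<not> d dvd m" for m
    proof -
      have "z ^ m * fps_nth v m = fps_nth v m" using arg_cong[OF z(2), of "\<lambda>u. fps_nth u m"] by simp
      moreover have "z ^ m \<noteq> 1" using d(2) that by blast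
      ultimately show ?thesis by simp
    qed
    then have vw: "v = w oo fps_X ^ d"
      using d(1) by (intro fps_ext) (auto simp: fps_nth_compose_X_power w_def)
    obtain M where M: "M \<ge> 1" "\<And>i. norm (fps_nth v i) \<le> M * M ^ i"
      using convergent_fps_bound[OF v] by blast
    have w: "convergent_fps w"
    proof (rule convergent_fps_boundI)
      show "norm (fps_nth w i) \<le> M * (M ^ d) ^ i" for i
        using M(2)[of "d * i"] by (simp add: w_def power_mult)
    qed (use M(1) in auto)
    define s where "s = \<tau> ^ d"
    have s0: "fps_nth s 0 = 0" using \<tau>(2) d(1) by (simp add: s_def)
    have Xd: "fps_nth (fps_X ^ d :: complex fps) 0 = 0" using d(1) by simp
    have "subdegree s \<ge> 2" using d(1) st by (simp add: s_def)
    moreover have "convergent_fps s" unfolding s_def by (intro convergent_fps_power \<tau>)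
    moreover have "y = w oo s"
      using fps_compose_assoc[OF \<tau>(2) Xd, of w]
      by (simp add: y vw s_def fps_X_power_compose[OF \<tau>(2)])
    moreover have "x = fps_X ^ (n div d) oo s"
      using d(2)[OF z(1)] by (simp add: fps_X_power_compose[OF s0]) (simp add: s_def \<tau>(4) flip: power_mult)
    moreover have "convergent_fps (fps_X ^ (n div d))"
      by (intro convergent_fps_power convergent_fps_X)
    ultimately show False
      using p w s0 unfolding irreducible_parametrization_def by blast
  qed
  moreover have "x = fps_X ^ n oo \<tau>" by (simp add: fps_X_power_compose[OF \<tau>(2)] \<tau>(4))
  moreover have "fps_nth v 0 = 0" using xy by (simp add: v_def)
  ultimately show ?thesis using that v \<tau>(2) st y unfolding n_def by blast
qed

lemma coeff2_mult_00: "coeff2 (g * h) 0 0 = coeff2 g 0 0 * coeff2 h 0 0"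
  by (simp add: coeff2_def times_series2.rep_eq)

lemma coeff2_unit: "g dvd 1 \<Longrightarrow> coeff2 g 0 0 \<noteq> 0"
proof -
  assume "g dvd 1"
  then obtain h where "1 = g * h" by auto
  from arg_cong[OF this, of "\<lambda>g. coeff2 g 0 0"] show ?thesis
    by (auto simp: coeff2_mult_00 coeff2_def[of 1] one_series2.rep_eq)
qed

text \<open>If x = 0, then f(0, y(t)) = 0 with y nonzero forces f(0, Y) = 0, so x divides f. By
  irreducibility the cofactor is a unit, and its constant term is f_x at the origin, contradicting
  singularity.\<close>

lemma singular_branch_not_vertical:
  assumes f: "singular_branch f" and p: "parametrization f x y"
  shows "x \<noteq> 0"
proof
  assume x: "x = 0"
  have y: "y \<noteq> 0" "fps_nth y 0 = 0" "subst2 f 0 y = 0" using p x by (auto simp: parametrization_def)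
  define a where "a = Abs_fps (coeff2 f 0)"
  have "fps_nth (subst2 f 0 y) m = fps_nth (a oo y) m" for m
  proof -
    have "(\<Sum>i\<le>m. \<Sum>j\<le>m. coeff2 f i j * fps_nth (0 ^ i * y ^ j) m)
        = (\<Sum>i\<in>{0}. \<Sum>j\<le>m. coeff2 f i j * fps_nth (0 ^ i * y ^ j) m)"
      by (intro sum.mono_neutral_right) (auto simp: zero_power)
    then show ?thesis by (simp add: subst2_def fps_compose_nth a_def atMost_atLeast0)
  qed
  then have "a oo y = 0" using y(3) by (intro fps_ext) simp
  then have a: "a = 0" using fps_compose_eq_0_iff[OF y(2), of a] y(1) by simp
  define F where "F = Rep_series2 f"
  define H where "H = Abs_fps (\<lambda>j. fps_shift 1 (fps_nth F j))"
  have F: "convergent_fps2 F" using Rep_series2[of f] by (simp add: F_def)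
  have "convergent_fps2 H"
    by (rule convergent_fps2_subsample[OF F, of _ 1 1 1]) (simp add: H_def)
  then have H: "Rep_series2 (Abs_series2 H) = H" by (simp add: Abs_series2_inverse)
  define Z where "Z = Abs_series2 (fps_const fps_X)"
  have Z: "Rep_series2 Z = fps_const fps_X"
    using convergent_fps2_fps_const[OF convergent_fps_X] by (simp add: Z_def Abs_series2_inverse)
  have "F = fps_const fps_X * H"
  proof (rule fps_ext)
    fix j
    have "fps_nth (fps_nth F j) 0 = 0"
      using arg_cong[OF a, of "\<lambda>a. fps_nth a j"] by (simp add: a_def coeff2_def F_def)
    then show "fps_nth F j = fps_nth (fps_const fps_X * H) j"
      by (intro fps_ext) (simp add: H_def)
  qed
  then have "Rep_series2 f = Rep_series2 (Z * Abs_series2 H)"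
    by (simp add: times_series2.rep_eq Z H F_def)
  then have fX: "f = Z * Abs_series2 H" by (simp add: Rep_series2_inject)
  have "\<not> Z dvd 1" using coeff2_unit[of Z] by (auto simp: coeff2_def Z)
  then have "Abs_series2 H dvd 1"
    using f fX Factorial_Ring.irreducibleD by (auto simp: singular_branch_def)
  then have "coeff2 (Abs_series2 H) 0 0 \<noteq> 0" by (rule coeff2_unit)
  moreover have "coeff2 (Abs_series2 H) 0 0 = coeff2 (deriv_x f) 0 0"
    unfolding coeff2_def H by (simp add: H_def F_def deriv_x.rep_eq)
  ultimately show False using f by (simp add: singular_branch_def)
qed

theorem corollary2:
  fixes f A B :: series2 and x y :: "complex fps"
  assumes "singular_branch f"
    and "singular_vector_field A B"
    and "\<not> invariant_branch A B f"
    and "irreducible_parametrization f x y"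
  shows "int (conductor f) = int (tang A B f) - int (form_val x y (- B) A) + 1"
proof -
  have p: "parametrization f x y" using assms(4) by (simp add: irreducible_parametrization_def)
  then have x0: "fps_nth x 0 = 0" and y0: "fps_nth y 0 = 0" and f0: "subst2 f x y = 0"
    by (auto simp: parametrization_def)
  have x: "x \<noteq> 0" by (rule singular_branch_not_vertical[OF assms(1) p])
  define n where "n = subdegree x"
  have n: "n > 0" using x x0 unfolding n_def by (metis gr0I nth_subdegree_nonzero)
  obtain v \<tau> where v: "convergent_fps v" "fps_nth v 0 = 0" and \<tau>: "fps_nth \<tau> 0 = 0" "subdegree \<tau> = 1"
    and xy: "x = fps_X ^ n oo \<tau>" "y = v oo \<tau>"
    and inj: "\<And>z. z ^ n = 1 \<Longrightarrow> rot z v = v \<Longrightarrow> z = 1"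
    using irreducible_parametrization_normal_form[OF assms(4) x] unfolding n_def by blast
  have \<tau>0: "\<tau> \<noteq> 0" using \<tau>(2) by auto
  have subst: "subst2 g x y = subst2 g (fps_X ^ n) v oo \<tau>" for g
    unfolding xy using n by (intro subst2_compose v \<tau>) auto
  interpret branch_normal_form f n v
  proof
    show "Factorial_Ring.irreducible f" using assms(1) by (simp add: singular_branch_def)
    show "subst2 f (fps_X ^ n) v = 0"
      using f0 \<tau>0 by (simp add: subst fps_compose_eq_0_iff[OF \<tau>(1)])
  qed (use n v inj in auto)
  \<comment> \<open>Composition with \<tau>, which has order 1, preserves orders, so they may be
    computed in either parametrization.\<close>
  have sd: "subdegree (subst2 g x y) = subdegree (\<pi> g)" for g
    using \<tau> by (simp add: subst \<pi>_def)
  have nz: "subst2 g x y = 0 \<longleftrightarrow> \<pi> g = 0" for g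
    using \<tau>0 by (simp add: subst \<pi>_def fps_compose_eq_0_iff[OF \<tau>(1)])
  define Xf where "Xf = vector_field A B f"
  have Xf: "\<pi> Xf \<noteq> 0" using assms(3) by (simp add: \<pi>_eq_0_iff Xf_def invariant_branch_def)
  have tang: "tang A B f = subdegree (\<pi> Xf)"
    using intersection_mult_eq[OF Xf]
    by (simp add: tang_def Xf_def intersection_mult_def insert_commute)
  interpret h: comm_ring_hom "\<lambda>g. subst2 g x y" by (rule comm_ring_hom_subst2[OF x0 y0])
  define \<omega> where "\<omega> = subst2 (- B) x y * fps_deriv x + subst2 A x y * fps_deriv y"
  have "subst2 (deriv_x f) x y * fps_deriv x = - subst2 (deriv_y f) x y * fps_deriv y"
    using fps_deriv_subst2[OF x0 y0, of f] f0 by (simp add: eq_neg_iff_add_eq_0)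
  then have "subst2 A x y * (subst2 (deriv_x f) x y * fps_deriv x)
      = subst2 A x y * (- subst2 (deriv_y f) x y * fps_deriv y)"
    by simp
  then have "fps_deriv x * subst2 Xf x y = - subst2 (deriv_y f) x y * \<omega>"
    by (simp add: Xf_def vector_field_def h.h_add h.h_mult h.h_uminus \<omega>_def algebra_simps)
  moreover have "\<pi> (deriv_y f) \<noteq> 0" using \<pi>_deriv_y_f D_nonzero by auto
  moreover have "fps_deriv x \<noteq> 0" "subdegree (fps_deriv x) = n - 1"
    using subdegree_fps_deriv[of x] n by (auto simp: n_def)
  \<comment> \<open>The left side of the product identity is nonzero by non-invariance, so \<omega>
    is nonzero as well: orders add, and \<open>form_val\<close> is not taking the default value of
    \<open>subdegree\<close> at 0.\<close>
  ultimately have "n - 1 + subdegree (\<pi> Xf) = subdegree D + subdegree \<omega>"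
    using Xf nz sd subdegree_\<pi>_deriv_y_f arg_cong[of "fps_deriv x * subst2 Xf x y" _ subdegree]
    by (metis mult_eq_0_iff neg_equal_0_iff_equal subdegree_mult subdegree_uminus)
  moreover have "form_val x y (- B) A = subdegree \<omega> + 1" by (simp add: form_val_def \<omega>_def)
  ultimately show ?thesis
    using tang subdegree_D by (simp add: conductor_eq conductor_bound_def of_nat_diff)
qed

end
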